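(* Let $\boldsymbol\omega=(\omega_1,\dots,\omega_n)$ be non-random weights with $\omega_i>0$ and $\sum_{i=1}^n\omega_i=n$, and let $F\in\mathscr{R}^*_{-1}$ (tail index $\gamma=1$). Consider p-values $P_1,\dots,P_n$ such that under the global null $H_0^{\mathrm{global}}$ the joint distribution of $(1-P_1,\dots,1-P_n)$ is an MRV copula (in particular all its marginals are standard uniform), and let $C^*$ denote the limiting copula of $(1-P_1,\dots,1-P_n)$. Then the asymptotic type-I error ratio between the weighted combination test with $\gamma=1$ and the weighted Bonferroni test, $$r(C^* )=\lim_{\alpha\downarrow0}\frac{\mathbb{P}_{H_0^{\mathrm{global}}}\left(P_{\mathrm{comb}}^{F,\boldsymbol\omega}\le\alpha\right)}{\mathbb{P}_{H_0^{\mathrm{global}}}\left(P_{\mathrm{bon}}^{\boldsymbol\omega}\le\alpha\right)},$$ is non-decreasing in $C^*$ under the pointwise order. That is, for two such p-value vectors with limiting copulas $C_1^*$ and $C_2^*$ (and the same weights), if $C_1^*\preceq_{\mathrm{pw}}C_2^*$ then $r(C_1^* )\le r(C_2^* )$.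
   Context: The number $n$ of p-values is fixed; $H_0^{\mathrm{global}}$ is the global null hypothesis (all $n$ base null hypotheses are true) and $\mathbb{P}_{H_0^{\mathrm{global}}}$ is probability under it. For a CDF $F$, $\overline F=1-F$ and $Q_F(t)=\inf\{x\in\mathbb{R}:F(x)\ge t\}$ for $t\in(0,1)$; when the support of $F$ is $[c,\infty)$ set $Q_F(0)=c$. For $\gamma>0$, $\mathscr{R}_{-\gamma}$ is the class of CDFs $F$ with $\lim_{x\to\infty}\overline F(xy)/\overline F(x)=y^{-\gamma}$ for all $y>0$. $\mathscr{R}^*_{-\gamma}$ is the class of $F\in\mathscr{R}_{-\gamma}$ that are continuous and strictly increasing on their support, with support $[c,\infty)$ for some $c\in\mathbb{R}$. Weighted heavy-tailed combination test: for $F\in\mathscr{R}^*_{-\gamma}$, with $x^+=\max(0,x)$, $$\bar X_{n,\boldsymbol\omega}=\frac1n\sum_{i=1}^n Q_F\left((1-P_i/\omega_i)^+\right),\qquad P_{\mathrm{comb}}^{F,\boldsymbol\omega}=\min\left(1,\,n^{1-\gamma}\,\overline F(\bar X_{n,\boldsymbol\omega})\right).$$ Weighted Bonferroni test: $P_{\mathrm{bon}}^{\boldsymbol\omega}=\min\left(1,\,n\min_{i=1,\dots,n}P_i/\omega_i\right)$. MRV copula: for an $n$-dimensional copula $C$ let $D(u_1,\dots,u_n)=1-C(1-u_1,\dots,1-u_n)$. $C$ is an MRV copula if for some (real-valued) function $\ell$, $\lim_{s\downarrow0}s^{-1}D(sv_1,\dots,sv_n)=\ell(v_1,\dots,v_n)$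 for all $v_1,\dots,v_n\ge0$. Equivalently, there is a copula $C^*$ (the limiting copula of $C$, and of any random vector with copula $C$) with $\lim_{t\to\infty}C(u_1^{1/t},\dots,u_n^{1/t})^t=C^*(u_1,\dots,u_n)$ for all $u\in[0,1]^n$. Pointwise order: $C_1\preceq_{\mathrm{pw}}C_2$ means $C_1(u)\le C_2(u)$ for all $u\in[0,1]^n$. *)

theory Defs
  imports "HOL-Probability.Probability"
begin

definition is_cdf :: "(real \<Rightarrow> real) \<Rightarrow> bool" where
  "is_cdf F \<longleftrightarrow> (\<exists>N. real_distribution N \<and> F = cdf N)"

definition cdf_support :: "(real \<Rightarrow> real) \<Rightarrow> real set" where
  "cdf_support F = {x. \<forall>e>0. F (x - e) < F (x + e)}"

definition survival :: "(real \<Rightarrow> real) \<Rightarrow> real \<Rightarrow> real" where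
  "survival F x = 1 - F x"

text \<open>
  The value at \<open>0\<close> is the left endpoint \<open>c\<close> when the support is \<open>{c..}\<close>.
  Only arguments in \<open>{0..<1}\<close> are meaningful; the quantile at \<open>1\<close> is an arbitrary real
  number (for unbounded support), and enters the combination test only when some p-value
  is at most \<open>0\<close>, which for uniform p-values has probability \<open>0\<close>.
\<close>
definition quantile :: "(real \<Rightarrow> real) \<Rightarrow> real \<Rightarrow> real" where
  "quantile F t = (if t = 0 then Inf (cdf_support F) else Inf {x. t \<le> F x})"

definition reg_varying_cdf :: "real \<Rightarrow> (real \<Rightarrow> real) \<Rightarrow> bool" where
  "reg_varying_cdf \<gamma> F \<longleftrightarrow> 0 < \<gamma> \<and> is_cdf F \<and>
     (\<forall>y>0. ((\<lambda>x. survival F (x * y) / survival F x) \<longlongrightarrow> y powr (- \<gamma>)) at_top)"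

text \<open>
  Continuity is required relative to the support only, so an atom at the left endpoint
  is not excluded.
\<close>
definition reg_varying_cdf_star :: "real \<Rightarrow> (real \<Rightarrow> real) \<Rightarrow> bool" where
  "reg_varying_cdf_star \<gamma> F \<longleftrightarrow> reg_varying_cdf \<gamma> F \<and>
     continuous_on (cdf_support F) F \<and> strict_mono_on (cdf_support F) F \<and>
     (\<exists>c. cdf_support F = {c..})"

definition comb_statistic :: "(real \<Rightarrow> real) \<Rightarrow> real ^ 'n \<Rightarrow> real ^ 'n \<Rightarrow> real" where
  "comb_statistic F \<omega> p =
     (1 / real CARD('n)) * (\<Sum>i\<in>UNIV. quantile F (max 0 (1 - p $ i / \<omega> $ i)))"

definition comb_pvalue :: "real \<Rightarrow> (real \<Rightarrow> real) \<Rightarrow> real ^ 'n \<Rightarrow> real ^ 'n \<Rightarrow> real" where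
  "comb_pvalue \<gamma> F \<omega> p =
     min 1 (real CARD('n) powr (1 - \<gamma>) * survival F (comb_statistic F \<omega> p))"

definition bonferroni_pvalue :: "real ^ 'n \<Rightarrow> real ^ 'n \<Rightarrow> real" where
  "bonferroni_pvalue \<omega> p = min 1 (real CARD('n) * (MIN i. p $ i / \<omega> $ i))"

definition joint_cdf :: "'a measure \<Rightarrow> ('a \<Rightarrow> real ^ 'n) \<Rightarrow> real ^ 'n \<Rightarrow> real" where
  "joint_cdf M X u = measure M {w \<in> space M. \<forall>i. X w $ i \<le> u $ i}"

definition unit_cube :: "(real ^ 'n) set" where
  "unit_cube = {u. \<forall>i. 0 \<le> u $ i \<and> u $ i \<le> 1}"

text \<open>
  A copula is a function on the unit cube; the values of \<open>C\<close> elsewhere are irrelevant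
  in this and all subsequent notions.
\<close>
definition copula :: "(real ^ 'n \<Rightarrow> real) \<Rightarrow> bool" where
  "copula C \<longleftrightarrow> (\<exists>N :: (real ^ 'n) measure.
     prob_space N \<and> sets N = sets borel \<and>
     (\<forall>i. distr N borel (\<lambda>x. x $ i) = uniform_measure lborel {0..1}) \<and>
     (\<forall>u\<in>unit_cube. C u = joint_cdf N (\<lambda>x. x) u))"

definition copula_dual :: "(real ^ 'n \<Rightarrow> real) \<Rightarrow> real ^ 'n \<Rightarrow> real" where
  "copula_dual C u = 1 - C (\<chi> i. 1 - u $ i)"

definition mrv_copula :: "(real ^ 'n \<Rightarrow> real) \<Rightarrow> bool" where
  "mrv_copula C \<longleftrightarrow> copula C \<and>
     (\<exists>l :: real ^ 'n \<Rightarrow> real. \<forall>v. (\<forall>i. 0 \<le> v $ i) \<longrightarrow>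
        ((\<lambda>s. copula_dual C (s *\<^sub>R v) / s) \<longlongrightarrow> l v) (at_right 0))"

definition limiting_copula :: "(real ^ 'n \<Rightarrow> real) \<Rightarrow> (real ^ 'n \<Rightarrow> real) \<Rightarrow> bool" where
  "limiting_copula C Cs \<longleftrightarrow> copula Cs \<and>
     (\<forall>u\<in>unit_cube. ((\<lambda>t. C (\<chi> i. u $ i powr (1 / t)) powr t) \<longlongrightarrow> Cs u) at_top)"

definition pw_le :: "(real ^ 'n \<Rightarrow> real) \<Rightarrow> (real ^ 'n \<Rightarrow> real) \<Rightarrow> bool"
    (infix "\<preceq>\<^sub>p\<^sub>w" 50) where
  "C1 \<preceq>\<^sub>p\<^sub>w C2 \<longleftrightarrow> (\<forall>u\<in>unit_cube. C1 u \<le> C2 u)"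

text \<open>
  \<open>M\<close> is the probability space under the global null hypothesis. Agreement of the joint
  distribution function with \<open>C\<close> on the unit cube determines the law of \<open>1 - P\<close> and
  forces \<open>P\<close> to lie in the unit cube almost surely.
\<close>
definition mrv_pvalues ::
    "'a measure \<Rightarrow> ('a \<Rightarrow> real ^ 'n) \<Rightarrow> (real ^ 'n \<Rightarrow> real) \<Rightarrow> bool" where
  "mrv_pvalues M P Cs \<longleftrightarrow> prob_space M \<and> P \<in> borel_measurable M \<and>
     (\<exists>C. mrv_copula C \<and>
          (\<forall>u\<in>unit_cube. joint_cdf M (\<lambda>w. \<chi> i. 1 - P w $ i) u = C u) \<and>
          limiting_copula C Cs)"

definition type1_error_ratio ::
    "'a measure \<Rightarrow> real \<Rightarrow> (real \<Rightarrow> real) \<Rightarrow> real ^ 'n \<Rightarrow> ('a \<Rightarrow> real ^ 'n) \<Rightarrow> real \<Rightarrow> real" where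
  "type1_error_ratio M \<gamma> F \<omega> P \<alpha> =
     measure M {w \<in> space M. comb_pvalue \<gamma> F \<omega> (P w) \<le> \<alpha>} /
     measure M {w \<in> space M. bonferroni_pvalue \<omega> (P w) \<le> \<alpha>}"

end

theory Submission
  imports Defs "HOL-Real_Asymp.Real_Asymp"
begin

text \<open>
  Put \<open>\<lambda>\<^sub>i = \<omega>\<^sub>i / n\<close>, so that the \<open>\<lambda>\<^sub>i\<close> sum to \<open>1\<close>, and let \<open>l v\<close> be the limit of
  \<open>Prob(\<exists>i. P\<^sub>i \<le> s v\<^sub>i) / s\<close> as \<open>s\<close> decreases to \<open>0\<close>. Both tests reject at level \<open>\<alpha>\<close> with a
  probability that is asymptotically linear in \<open>\<alpha>\<close>.

  The Bonferroni test rejects if and only if \<open>P\<^sub>i \<le> \<alpha> \<lambda>\<^sub>i\<close> for some \<open>i\<close>, so its slope is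
  \<open>l \<lambda>\<close> (\<open>bonferroni_rejection_rate\<close>). The combination test has slope \<open>1\<close> whatever the
  dependence (\<open>combination_rejection_rate\<close>), so the error ratio tends to \<open>1 / l \<lambda>\<close>.
  Finally the limiting copula takes the value \<open>exp (- l v)\<close> at the point with coordinates
  \<open>exp (- v\<^sub>i)\<close> (\<open>mrv_pvaluesE\<close>). A pointwise larger limiting copula therefore has a
  smaller \<open>l \<lambda>\<close> and a larger ratio.

  That the combination test has slope \<open>1\<close> rests on two facts.

  First, \<open>t Prob(S \<ge> t)\<close> tends to \<open>1\<close> for the weighted Pareto sum
  \<open>S = \<Sum>\<^sub>i \<lambda>\<^sub>i / P\<^sub>i\<close> (\<open>sum_tail_limit\<close>, \<open>weighted_sum_tail\<close>). Multivariate regular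
  variation gives the scaled limit of the probability of every union of exceedances
  \<open>{Z\<^sub>i \<ge> a t}\<close> with \<open>Z\<^sub>i = \<lambda>\<^sub>i / P\<^sub>i\<close>, hence, by inclusion-exclusion, of every event
  that depends on finitely many exceedances and excludes the case that none occurs
  (\<open>scaled_event_limit\<close>). Rounding the \<open>Z\<^sub>i\<close> down to a grid produces such
  an event, which contains \<open>{S \<ge> (1 + \<epsilon>) t}\<close> and is contained in \<open>{S \<ge> t}\<close>; so
  \<open>g t = t Prob(S \<ge> t)\<close> oscillates little at infinity. Its limit is found
  by counting the integers in \<open>{1..N}\<close> below \<open>S\<close> and below the \<open>Z\<^sub>i\<close>: up to a bounded error in
  expectation the counts agree, so \<open>\<Sum>j\<le>N. (g j - 1) / j\<close> is bounded in \<open>N\<close>. As the harmonic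
  series diverges, the limit can only be \<open>1\<close>.

  Second, by regular variation with index \<open>1\<close>, if \<open>\<alpha> = 1 - F q\<close> is small then
  the quantile of \<open>F\<close> at \<open>1 - 1 / z\<close> is close to \<open>q \<alpha> z\<close>, relative to \<open>q\<close> and
  uniformly for \<open>\<alpha> z\<close> in a bounded range (\<open>quantile_asymp_uniform\<close>). Hence the rejection region
  of the combination test lies between \<open>{S \<ge> (1 + \<epsilon>) / \<alpha>}\<close> and \<open>{S \<ge> (1 - \<epsilon>) / \<alpha>}\<close>
  (\<open>mean_quantile_comparison\<close>).
\<close>

section \<open>Scaled limits of events built from finitely many exceedances\<close>

text \<open>
  If all nonempty finite unions of the events \<open>E g s\<close> have convergent scaled
  probability, so do the atoms of the algebra that they generate, except for the atom
  on which none of them occurs. The induction removes one event at a time from the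
  intersection, at the cost of one more event in the subtracted union.
\<close>

lemma (in prob_space) scaled_atom_limit:
  fixes E :: "'i \<Rightarrow> 'b \<Rightarrow> 'a set" and b :: "'b \<Rightarrow> real"
  assumes ev: "\<And>g s. E g s \<in> events"
    and un: "\<And>G. finite G \<Longrightarrow> G \<subseteq> \<Gamma> \<Longrightarrow> G \<noteq> {} \<Longrightarrow>
               \<exists>l. ((\<lambda>s. b s * prob (\<Union>g\<in>G. E g s)) \<longlongrightarrow> l) \<F>"
    and "finite A" "A \<noteq> {}" "A \<subseteq> \<Gamma>" "finite B" "B \<subseteq> \<Gamma>"
  shows "\<exists>l. ((\<lambda>s. b s * prob ((\<Inter>g\<in>A. E g s) - (\<Union>g\<in>B. E g s))) \<longlongrightarrow> l) \<F>"
  using assms(3-)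
proof (induction A arbitrary: B rule: finite_ne_induct)
  case (singleton g)
  have un': "\<exists>l. ((\<lambda>s. b s * prob (\<Union>g\<in>G. E g s)) \<longlongrightarrow> l) \<F>" if "finite G" "G \<subseteq> \<Gamma>" for G
    using un[of G] that by (cases "G = {}") (auto intro: exI[of _ 0])
  obtain k1 where k1: "((\<lambda>s. b s * prob (\<Union>g\<in>insert g B. E g s)) \<longlongrightarrow> k1) \<F>"
    using un'[of "insert g B"] singleton by auto
  obtain k2 where k2: "((\<lambda>s. b s * prob (\<Union>g\<in>B. E g s)) \<longlongrightarrow> k2) \<F>"
    using un'[of B] singleton by auto
  have "prob ((\<Inter>h\<in>{g}. E h s) - (\<Union>h\<in>B. E h s))
      = prob (\<Union>h\<in>insert g B. E h s) - prob (\<Union>h\<in>B. E h s)" for s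
  proof -
    have "(\<Union>h\<in>B. E h s) \<in> events" "(\<Union>h\<in>insert g B. E h s) \<in> events"
      using ev singleton by (auto intro!: sets.finite_UN simp del: UN_insert)
    then have "prob ((\<Union>h\<in>insert g B. E h s) - (\<Union>h\<in>B. E h s))
      = prob (\<Union>h\<in>insert g B. E h s) - prob (\<Union>h\<in>B. E h s)"
      by (intro finite_measure_Diff) auto
    moreover have "(\<Inter>h\<in>{g}. E h s) - (\<Union>h\<in>B. E h s)
        = (\<Union>h\<in>insert g B. E h s) - (\<Union>h\<in>B. E h s)" by auto
    ultimately show ?thesis by simp
  qed
  with tendsto_diff[OF k1 k2] show ?case
    by (intro exI[of _ "k1 - k2"]) (simp only: right_diff_distrib)
next
  case (insert g A)
  obtain k1 where k1: "((\<lambda>s. b s * prob ((\<Inter>g\<in>A. E g s) - (\<Union>g\<in>B. E g s))) \<longlongrightarrow> k1) \<F>"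
    using insert.IH[of B] insert.prems by auto
  obtain k2 where k2:
    "((\<lambda>s. b s * prob ((\<Inter>g\<in>A. E g s) - (\<Union>g\<in>insert g B. E g s))) \<longlongrightarrow> k2) \<F>"
    using insert.IH[of "insert g B"] insert.prems by auto
  have "prob ((\<Inter>h\<in>insert g A. E h s) - (\<Union>h\<in>B. E h s))
      = prob ((\<Inter>h\<in>A. E h s) - (\<Union>h\<in>B. E h s))
        - prob ((\<Inter>h\<in>A. E h s) - (\<Union>h\<in>insert g B. E h s))" for s
  proof -
    have "(\<Inter>h\<in>A. E h s) \<in> events"
      using ev insert.hyps by (intro sets.finite_INT) auto
    moreover have "(\<Union>h\<in>B. E h s) \<in> events" "(\<Union>h\<in>insert g B. E h s) \<in> events"
      using ev insert.prems by (auto intro!: sets.finite_UN simp del: UN_insert)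
    ultimately have "prob (((\<Inter>h\<in>A. E h s) - (\<Union>h\<in>B. E h s))
          - ((\<Inter>h\<in>A. E h s) - (\<Union>h\<in>insert g B. E h s)))
      = prob ((\<Inter>h\<in>A. E h s) - (\<Union>h\<in>B. E h s))
        - prob ((\<Inter>h\<in>A. E h s) - (\<Union>h\<in>insert g B. E h s))"
      by (intro finite_measure_Diff) auto
    moreover have "(\<Inter>h\<in>insert g A. E h s) - (\<Union>h\<in>B. E h s)
        = ((\<Inter>h\<in>A. E h s) - (\<Union>h\<in>B. E h s))
          - ((\<Inter>h\<in>A. E h s) - (\<Union>h\<in>insert g B. E h s))" by auto
    ultimately show ?thesis by simp
  qed
  with tendsto_diff[OF k1 k2] show ?case
    by (intro exI[of _ "k1 - k2"]) (simp only: right_diff_distrib)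
qed

lemma (in prob_space) scaled_event_limit:
  fixes E :: "'i \<Rightarrow> 'b \<Rightarrow> 'a set" and b :: "'b \<Rightarrow> real"
  assumes ev: "\<And>g s. E g s \<in> events" and \<Gamma>: "finite \<Gamma>"
    and un: "\<And>G. G \<subseteq> \<Gamma> \<Longrightarrow> G \<noteq> {} \<Longrightarrow>
               \<exists>l. ((\<lambda>s. b s * prob (\<Union>g\<in>G. E g s)) \<longlongrightarrow> l) \<F>"
    and Q: "\<not> Q {}"
  shows "\<exists>l. ((\<lambda>s. b s * prob {w \<in> space M. Q {g \<in> \<Gamma>. w \<in> E g s}}) \<longlongrightarrow> l) \<F>"
proof -
  \<comment> \<open>The outcomes on which exactly the events in \<open>A\<close> occur among those indexed by \<open>\<Gamma>\<close>.\<close>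
  define atm where "atm A s = (\<Inter>g\<in>A. E g s) - (\<Union>g\<in>\<Gamma> - A. E g s)" for A s
  define I where "I = {A \<in> Pow \<Gamma>. Q A}"
  have I: "finite I" "{} \<notin> I" "\<And>A. A \<in> I \<Longrightarrow> A \<subseteq> \<Gamma>" "\<And>A. A \<in> I \<Longrightarrow> finite A"
    using \<Gamma> Q by (auto simp: I_def intro: finite_subset)
  have "\<exists>l. ((\<lambda>s. b s * prob (atm A s)) \<longlongrightarrow> l) \<F>" if "A \<in> I" for A
    unfolding atm_def
    by (rule scaled_atom_limit[where \<Gamma>=\<Gamma>, OF ev un]) (use I that \<Gamma> in auto)
  then obtain L where L: "\<And>A. A \<in> I \<Longrightarrow> ((\<lambda>s. b s * prob (atm A s)) \<longlongrightarrow> L A) \<F>"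
    by metis
  have atm_ev: "atm A s \<in> events" if "A \<in> I" for A s
  proof -
    have "A \<noteq> {}" "finite A" using I that by auto
    then have "(\<Inter>g\<in>A. E g s) \<in> events" using ev by (intro sets.finite_INT) auto
    moreover have "(\<Union>g\<in>\<Gamma> - A. E g s) \<in> events" using ev \<Gamma> by (intro sets.finite_UN) auto
    ultimately show ?thesis by (auto simp: atm_def)
  qed
  have eq: "{w \<in> space M. Q {g \<in> \<Gamma>. w \<in> E g s}} = (\<Union>A\<in>I. atm A s)" for s
  proof (intro set_eqI iffI)
    fix w assume "w \<in> {w \<in> space M. Q {g \<in> \<Gamma>. w \<in> E g s}}"
    then show "w \<in> (\<Union>A\<in>I. atm A s)"
      by (intro UN_I[of "{g \<in> \<Gamma>. w \<in> E g s}"]) (auto simp: I_def atm_def)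
  next
    fix w assume "w \<in> (\<Union>A\<in>I. atm A s)"
    then obtain A where A: "A \<in> I" "w \<in> atm A s" by auto
    then have "{g \<in> \<Gamma>. w \<in> E g s} = A" using I(3) by (auto simp: atm_def)
    moreover have "w \<in> space M" using sets.sets_into_space[OF atm_ev] A by blast
    ultimately show "w \<in> {w \<in> space M. Q {g \<in> \<Gamma>. w \<in> E g s}}" using A by (auto simp: I_def)
  qed
  have "disjoint_family_on (\<lambda>A. atm A s) I" for s
  proof (unfold disjoint_family_on_def, intro ballI impI)
    fix A B assume "A \<in> I" "B \<in> I" "A \<noteq> B"
    then show "atm A s \<inter> atm B s = {}"
      using I(3)[of A] I(3)[of B] unfolding atm_def by blast
  qed
  then have "prob (\<Union>A\<in>I. atm A s) = (\<Sum>A\<in>I. prob (atm A s))" for s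
    using I atm_ev by (intro finite_measure_finite_Union) auto
  moreover have "((\<lambda>s. \<Sum>A\<in>I. b s * prob (atm A s)) \<longlongrightarrow> (\<Sum>A\<in>I. L A)) \<F>"
    by (intro tendsto_sum L)
  ultimately show ?thesis
    by (intro exI[of _ "\<Sum>A\<in>I. L A"]) (simp add: eq sum_distrib_left)
qed

section \<open>A harmonic averaging argument\<close>

text \<open>
  Only a one-sided bound on the weighted partial sums is needed: were \<open>g\<close> eventually at
  least \<open>b > c\<close>, they would exceed \<open>(b - c)\<close> times the harmonic sum, up to a constant.
\<close>

lemma harmonic_sum_bounded_imp_le:
  fixes g :: "nat \<Rightarrow> real"
  assumes bd: "\<And>N. (\<Sum>j=1..N. (g j - c) / real j) \<le> K"
    and ev: "eventually (\<lambda>j. b \<le> g j) sequentially"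
  shows "b \<le> c"
proof (rule ccontr)
  assume "\<not> b \<le> c"
  then have d: "b - c > 0" by simp
  from ev obtain J where J: "\<And>j. j \<ge> J \<Longrightarrow> b \<le> g j" by (auto simp: eventually_sequentially)
  define L where "L = (\<Sum>j=1..J. (g j - c) / real j)"
  have "(b - c) * (harm N - harm J) \<le> K - L" if "N \<ge> J" for N
  proof -
    have sp: "(\<Sum>j=1..N. f j) = (\<Sum>j=1..J. f j) + (\<Sum>j=Suc J..N. f j)" for f :: "nat \<Rightarrow> real"
      using that by (metis add.commute le_add1 plus_1_eq_Suc sum.ub_add_nat ordered_cancel_comm_monoid_diff_class.add_diff_inverse)
    have "(b - c) * (harm N - harm J) = (\<Sum>j=Suc J..N. (b - c) / real j)"
      unfolding harm_def sp[of "\<lambda>j. inverse (real j)"] by (simp add: sum_distrib_left divide_inverse)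
    also have "\<dots> \<le> (\<Sum>j=Suc J..N. (g j - c) / real j)"
      by (intro sum_mono divide_right_mono) (use J in auto)
    also have "\<dots> = (\<Sum>j=1..N. (g j - c) / real j) - L"
      by (simp only: sp[of "\<lambda>j. (g j - c) / real j"] L_def)
    also have "\<dots> \<le> K - L" using bd[of N] by simp
    finally show ?thesis .
  qed
  then have le: "harm N \<le> (K - L) / (b - c) + harm J" if "N \<ge> J" for N
    using d that by (fastforce simp: field_simps)
  have "filterlim (harm :: nat \<Rightarrow> real) at_top sequentially" by (rule harm_at_top)
  then have "eventually (\<lambda>N. harm N > (K - L) / (b - c) + harm J) sequentially"
    by (simp add: filterlim_at_top_dense)
  then have "eventually (\<lambda>N. False) sequentially"
    using eventually_ge_at_top[of J] by eventually_elim (use le in force)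
  then show False by simp
qed

section \<open>Counting integers below a sum\<close>

text \<open>
  The number of \<open>j \<in> {1..N}\<close> with \<open>j \<le> x\<close>. For \<open>x \<ge> 0\<close> it is the integer part of \<open>x\<close>
  truncated at \<open>N\<close>.
\<close>

definition count_upto :: "nat \<Rightarrow> real \<Rightarrow> nat" where
  "count_upto N x = card {j \<in> {1..N}. real j \<le> x}"

lemma count_upto_eq:
  assumes "0 \<le> x"
  shows "real (count_upto N x) = min (real N) (of_int \<lfloor>x\<rfloor>)"
proof -
  have "{j \<in> {1..N}. real j \<le> x} = {1..min N (nat \<lfloor>x\<rfloor>)}"
    using assms by (auto simp: le_nat_iff le_floor_iff)
  then have "count_upto N x = min N (nat \<lfloor>x\<rfloor>)" by (simp add: count_upto_def)
  then show ?thesis using assms by (auto simp: min_def of_nat_nat le_nat_iff)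
qed

lemma count_upto_full:
  assumes "real N \<le> x"
  shows "count_upto N x = N"
proof -
  have "{j \<in> {1..N}. real j \<le> x} = {1..N}"
    using assms by (auto intro: order_trans[of _ "real N"])
  then show ?thesis by (simp add: count_upto_def)
qed

lemma count_upto_le:
  assumes "0 \<le> x"
  shows "real (count_upto N x) \<le> x"
  unfolding count_upto_eq[OF assms] by linarith

lemma count_upto_ge:
  assumes "0 \<le> x" "x < real N"
  shows "x - 1 \<le> real (count_upto N x)"
proof -
  have "x - 1 \<le> of_int \<lfloor>x\<rfloor>" by linarith
  then show ?thesis using assms by (simp add: count_upto_eq)
qed

text \<open>
  Counting is additive up to the number of summands, except when the sum reaches the
  truncation level \<open>N\<close>; then the error can be of order \<open>N\<close>, in one direction only.
\<close>

lemma count_upto_sum_bound: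
  fixes z :: "'n::finite \<Rightarrow> real"
  assumes z: "\<And>i. 0 \<le> z i"
  shows "real (count_upto N (\<Sum>i\<in>UNIV. z i)) - (\<Sum>i\<in>UNIV. real (count_upto N (z i)))
           \<le> real CARD('n)" (is "?l - ?r \<le> _")
    and "(\<Sum>i\<in>UNIV. real (count_upto N (z i))) - real (count_upto N (\<Sum>i\<in>UNIV. z i))
           \<le> real CARD('n) * real N * (if real N \<le> (\<Sum>i\<in>UNIV. z i) then 1 else 0)"
proof -
  have s0: "0 \<le> (\<Sum>i\<in>UNIV. z i)" using z by (simp add: sum_nonneg)
  have sz: "z i \<le> (\<Sum>i\<in>UNIV. z i)" for i using z by (intro member_le_sum) auto
  show "?l - ?r \<le> real CARD('n)"
  proof (cases "\<exists>i. real N \<le> z i")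
    case True
    then obtain i where "real N \<le> z i" by auto
    then have "real N \<le> real (count_upto N (z i))"
      by (simp add: count_upto_full)
    also have "\<dots> \<le> ?r" by (intro member_le_sum) auto
    also have "?l \<le> real N" using s0 by (simp add: count_upto_eq)
    ultimately show ?thesis by linarith
  next
    case False
    have "z i - 1 \<le> real (count_upto N (z i))" for i
      using False z[of i] by (intro count_upto_ge) (auto simp: not_le)
    then have "(\<Sum>i\<in>UNIV. z i - 1) \<le> ?r" by (intro sum_mono)
    moreover have "?l \<le> (\<Sum>i\<in>UNIV. z i)" using s0 by (rule count_upto_le)
    ultimately show ?thesis by (simp add: sum_subtractf)
  qed
  show "?r - ?l \<le> real CARD('n) * real N * (if real N \<le> (\<Sum>i\<in>UNIV. z i) then 1 else 0)"
  proof (cases "real N \<le> (\<Sum>i\<in>UNIV. z i)")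
    case True
    have "?r \<le> (\<Sum>i\<in>(UNIV::'n set). real N)" using z by (intro sum_mono) (simp add: count_upto_eq)
    then show ?thesis using True by simp
  next
    case False
    then have lt: "z i < real N" for i using sz[of i] by linarith
    have "of_int \<lfloor>z i\<rfloor> \<le> real N" for i using lt[of i] by linarith
    then have "?r = of_int (\<Sum>i\<in>UNIV. \<lfloor>z i\<rfloor>)"
      using z by (simp add: count_upto_eq)
    also have "(\<Sum>i\<in>UNIV. \<lfloor>z i\<rfloor>) \<le> \<lfloor>\<Sum>i\<in>UNIV. z i\<rfloor>"
      by (simp add: le_floor_iff sum_mono)
    also have "of_int \<lfloor>\<Sum>i\<in>UNIV. z i\<rfloor> = ?l"
      using False unfolding count_upto_eq[OF s0] by linarith
    finally show ?thesis using False by simp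
  qed
qed

lemma (in prob_space) expectation_count_upto:
  assumes [measurable]: "S \<in> borel_measurable M"
  shows "expectation (\<lambda>w. real (count_upto N (S w)))
           = (\<Sum>j=1..N. prob {w \<in> space M. real j \<le> S w})"
    and "integrable M (\<lambda>w. real (count_upto N (S w)))"
proof -
  have eq: "real (count_upto N (S w)) = (\<Sum>j=1..N. indicator {w \<in> space M. real j \<le> S w} w)"
    if "w \<in> space M" for w
  proof -
    have "(\<Sum>j=1..N. indicator {w \<in> space M. real j \<le> S w} w)
       = (\<Sum>j\<in>{1..N}. if real j \<le> S w then 1 else (0::real))"
      using that by (intro sum.cong) (auto simp: indicator_def)
    also have "\<dots> = real (card {j \<in> {1..N}. real j \<le> S w})"
      by (simp add: sum.If_cases Int_def)
    finally show ?thesis by (simp add: count_upto_def)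
  qed
  have int: "integrable M (\<lambda>w. indicator {w \<in> space M. real j \<le> S w} w :: real)" for j
    by (intro integrable_real_indicator) (auto simp: emeasure_eq_measure)
  show "integrable M (\<lambda>w. real (count_upto N (S w)))"
    by (subst Bochner_Integration.integrable_cong[OF refl eq]) (auto intro: int)
  have "expectation (\<lambda>w. real (count_upto N (S w)))
    = expectation (\<lambda>w. \<Sum>j=1..N. indicator {w \<in> space M. real j \<le> S w} w)"
    by (intro Bochner_Integration.integral_cong refl eq)
  also have "\<dots> = (\<Sum>j=1..N. expectation (indicator {w \<in> space M. real j \<le> S w}))"
    by (intro Bochner_Integration.integral_sum int)
  also have "\<dots> = (\<Sum>j=1..N. prob {w \<in> space M. real j \<le> S w})" by simp
  finally show "expectation (\<lambda>w. real (count_upto N (S w)))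
           = (\<Sum>j=1..N. prob {w \<in> space M. real j \<le> S w})" .
qed

section \<open>The tail of a sum of jointly regularly varying Pareto variables\<close>

text \<open>
  The limit does not depend on the dependence structure, although some joint regular
  variation (assumption \<open>lim\<close>) is needed for the limit to exist.
\<close>

lemma (in prob_space) sum_tail_limit:
  fixes Z :: "'n::finite \<Rightarrow> 'a \<Rightarrow> real" and lam :: "'n \<Rightarrow> real"
  assumes meas [measurable]: "\<And>i. Z i \<in> borel_measurable M"
    and nonneg: "\<And>i w. 0 \<le> Z i w"
    and tail: "\<And>i t. 1 \<le> t \<Longrightarrow> t * prob {w \<in> space M. t \<le> Z i w} = lam i"
    and lam: "(\<Sum>i\<in>UNIV. lam i) = 1"
    and lim: "\<And>G. finite G \<Longrightarrow> G \<noteq> {} \<Longrightarrow> (\<And>i a. (i, a) \<in> G \<Longrightarrow> 0 < a) \<Longrightarrow>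
       \<exists>l. ((\<lambda>t. t * prob {w \<in> space M. \<exists>(i, a)\<in>G. a * t \<le> Z i w}) \<longlongrightarrow> l) at_top"
  shows "((\<lambda>t. t * prob {w \<in> space M. t \<le> (\<Sum>i\<in>UNIV. Z i w)}) \<longlongrightarrow> 1) at_top"
proof -
  define n where "n = real CARD('n)"
  have n1: "n \<ge> 1" by (simp add: n_def Suc_leI)
  define S where "S w = (\<Sum>i\<in>UNIV. Z i w)" for w
  have [measurable]: "S \<in> borel_measurable M" unfolding S_def by measurable
  define g where "g t = t * prob {w \<in> space M. t \<le> S w}" for t
  have S0: "0 \<le> S w" for w using nonneg by (simp add: S_def sum_nonneg)

  have tail_le: "t * prob {w \<in> space M. t \<le> Z i w} \<le> 1" if "0 \<le> t" for i t
  proof (cases "1 \<le> t")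
    case True
    have "lam i \<le> 1" using tail[of 1 i] by (metis mult_1 order_refl prob_le_1)
    then show ?thesis using tail[OF True, of i] by simp
  next
    case False
    then show ?thesis using that by (intro mult_le_one) auto
  qed
  have g_le: "g t \<le> n * n" if "0 \<le> t" for t
  proof -
    have "prob {w \<in> space M. t \<le> S w} \<le> prob (\<Union>i\<in>UNIV. {w \<in> space M. t / n \<le> Z i w})"
    proof (intro finite_measure_mono)
      show "{w \<in> space M. t \<le> S w} \<subseteq> (\<Union>i\<in>UNIV. {w \<in> space M. t / n \<le> Z i w})"
      proof (rule subsetI, rule ccontr)
        fix w assume w: "w \<in> {w \<in> space M. t \<le> S w}" "w \<notin> (\<Union>i\<in>UNIV. {w \<in> space M. t / n \<le> Z i w})"
        then have "Z i w < t / n" for i by (auto simp: not_le)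
        then have "S w < (\<Sum>i\<in>(UNIV::'n set). t / n)"
          unfolding S_def by (intro sum_strict_mono) auto
        then show False using w n1 by (simp add: n_def)
      qed
    qed auto
    also have "\<dots> \<le> (\<Sum>i\<in>UNIV. prob {w \<in> space M. t / n \<le> Z i w})"
      by (intro finite_measure_subadditive_finite) auto
    finally have "g t \<le> t * (\<Sum>i\<in>UNIV. prob {w \<in> space M. t / n \<le> Z i w})"
      using that by (simp add: g_def mult_left_mono)
    also have "\<dots> = (\<Sum>i\<in>UNIV. n * (t / n * prob {w \<in> space M. t / n \<le> Z i w}))"
      using n1 by (simp add: sum_distrib_left)
    also have "\<dots> \<le> (\<Sum>i\<in>(UNIV::'n set). n * 1)"
      by (intro sum_mono mult_left_mono tail_le) (use that n1 in auto)
    finally show ?thesis by (simp add: n_def)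
  qed

  \<comment> \<open>The marginal tails are exactly \<open>lam i / j\<close>, so the terms \<open>1 / j\<close> are the expected counts of the \<open>Z i\<close>.\<close>
  have harm_eq: "(\<Sum>j=1..N. (g (real j) - 1) / real j)
      = expectation (\<lambda>w. real (count_upto N (S w)) - (\<Sum>i\<in>UNIV. real (count_upto N (Z i w))))" for N
  proof -
    have "(g (real j) - 1) / real j = prob {w \<in> space M. real j \<le> S w}
          - (\<Sum>i\<in>UNIV. prob {w \<in> space M. real j \<le> Z i w})" if "j \<in> {1..N}" for j
    proof -
      have "prob {w \<in> space M. real j \<le> Z i w} = lam i / real j" for i
        using tail[of "real j" i] that by (simp add: field_simps)
      then have "(\<Sum>i\<in>UNIV. prob {w \<in> space M. real j \<le> Z i w}) = 1 / real j"
        by (simp add: lam flip: sum_divide_distrib)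
      then show ?thesis using that by (simp add: g_def diff_divide_distrib)
    qed
    then have "(\<Sum>j=1..N. (g (real j) - 1) / real j) = (\<Sum>j=1..N. prob {w \<in> space M. real j \<le> S w})
          - (\<Sum>j=1..N. \<Sum>i\<in>UNIV. prob {w \<in> space M. real j \<le> Z i w})"
      by (simp flip: sum_subtractf)
    also have "(\<Sum>j=1..N. \<Sum>i\<in>UNIV. prob {w \<in> space M. real j \<le> Z i w})
        = (\<Sum>i\<in>UNIV. \<Sum>j=1..N. prob {w \<in> space M. real j \<le> Z i w})" by (rule sum.swap)
    finally show ?thesis
      by (simp add: expectation_count_upto Bochner_Integration.integral_sum)
  qed
  have up: "(\<Sum>j=1..N. (g (real j) - 1) / real j) \<le> n" for N
  proof -
    have "expectation (\<lambda>w. real (count_upto N (S w)) - (\<Sum>i\<in>UNIV. real (count_upto N (Z i w))))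
       \<le> expectation (\<lambda>w. n)"
      by (intro integral_mono Bochner_Integration.integrable_diff Bochner_Integration.integrable_sum
            expectation_count_upto)
         (auto simp: S_def n_def intro!: count_upto_sum_bound nonneg)
    then show ?thesis unfolding harm_eq by (simp add: prob_space)
  qed
  have down: "(\<Sum>j=1..N. (- g (real j) - (-1)) / real j) \<le> n * (n * n)" for N
  proof -
    have "expectation (\<lambda>w. (\<Sum>i\<in>UNIV. real (count_upto N (Z i w))) - real (count_upto N (S w)))
       \<le> expectation (\<lambda>w. n * real N * indicator {w \<in> space M. real N \<le> S w} w)"
    proof (intro integral_mono Bochner_Integration.integrable_diff Bochner_Integration.integrable_sum
            expectation_count_upto)
      show "integrable M (\<lambda>w. n * real N * indicator {w \<in> space M. real N \<le> S w} w)"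
        by (intro integrable_mult_right integrable_real_indicator) (auto simp: emeasure_eq_measure)
      fix w assume "w \<in> space M"
      then show "(\<Sum>i\<in>UNIV. real (count_upto N (Z i w))) - real (count_upto N (S w))
          \<le> n * real N * indicator {w \<in> space M. real N \<le> S w} w"
        using count_upto_sum_bound(2)[of "\<lambda>i. Z i w" N] nonneg
        by (auto simp: S_def n_def indicator_def)
    qed auto
    also have "\<dots> = n * g (real N)" by (simp add: g_def)
    also have "\<dots> \<le> n * (n * n)" using n1 g_le[of "real N"] by (intro mult_left_mono) auto
    finally have "- (\<Sum>j=1..N. (g (real j) - 1) / real j) \<le> n * (n * n)"
      unfolding harm_eq
      by (subst Bochner_Integration.integral_minus[symmetric]) simp
    moreover have "(\<Sum>j=1..N. (- g (real j) - (-1)) / real j) = - (\<Sum>j=1..N. (g (real j) - 1) / real j)"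
      unfolding sum_negf[symmetric] by (intro sum.cong refl) (simp add: field_simps)
    ultimately show ?thesis by simp
  qed

  \<comment> \<open>Any eventual lower bound of \<open>g\<close> is at most \<open>1\<close>, and any eventual upper bound is at least \<open>1\<close>.\<close>
  have lower: "b \<le> 1" if "eventually (\<lambda>t. b \<le> g t) at_top" for b
    using harmonic_sum_bounded_imp_le[of "\<lambda>j. g (real j)" 1 n b] up
      eventually_compose_filterlim[OF that filterlim_real_sequentially] by blast
  have upper: "1 \<le> b" if "eventually (\<lambda>t. g t \<le> b) at_top" for b
    using harmonic_sum_bounded_imp_le[of "\<lambda>j. - g (real j)" "-1" "n * (n * n)" "- b"] down
      eventually_compose_filterlim[OF that filterlim_real_sequentially] by simp

  have squeeze: "\<exists>L. eventually (\<lambda>t. L - \<epsilon> \<le> g t) at_top \<and>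
         eventually (\<lambda>t. g t \<le> (1 + \<epsilon>) * (L + \<epsilon>)) at_top" if \<epsilon>: "\<epsilon> > 0" for \<epsilon>
  proof -
    define \<delta> where "\<delta> = \<epsilon> / n"
    have \<delta>: "\<delta> > 0" "n * \<delta> = \<epsilon>" using \<epsilon> n1 by (auto simp: \<delta>_def)
    define K where "K = nat \<lceil>1 / \<delta>\<rceil>"
    have "1 / \<delta> \<le> real K" unfolding K_def by (rule real_nat_ceiling_ge)
    then have K: "1 \<le> real K * \<delta>" using \<delta> by (simp add: pos_divide_le_eq)
    \<comment> \<open>\<open>B t\<close> says that the sum of the \<open>Z i / t\<close>, each rounded down to the grid \<open>{0, \<delta>, \<dots>, K \<delta>}\<close>, is at least \<open>1\<close>.\<close>
    define E where "E = (\<lambda>(i, j) t. {w \<in> space M. real j * \<delta> * t \<le> Z i w})"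
    define \<Gamma> where "\<Gamma> = (UNIV :: 'n set) \<times> {1..K}"
    define Q where "Q = (\<lambda>A :: ('n \<times> nat) set. 1 \<le> \<delta> * real (card A))"
    define B where "B t = {w \<in> space M. Q {g \<in> \<Gamma>. w \<in> E g t}}" for t
    have "\<exists>L. ((\<lambda>t. t * prob {w \<in> space M. Q {g \<in> \<Gamma>. w \<in> E g t}}) \<longlongrightarrow> L) at_top"
    proof (rule scaled_event_limit)
      show "E g s \<in> events" for g s by (cases g) (simp add: E_def)
      show "finite \<Gamma>" "\<not> Q {}" by (auto simp: \<Gamma>_def Q_def)
      fix G assume G: "G \<subseteq> \<Gamma>" "G \<noteq> {}"
      define G' where "G' = (\<lambda>(i, j). (i, real j * \<delta>)) ` G"
      have "(\<Union>g\<in>G. E g t) = {w \<in> space M. \<exists>(i, a)\<in>G'. a * t \<le> Z i w}" for t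
        by (auto simp: E_def G'_def) force
      moreover have "finite G"
        using G(1) by (rule finite_subset) (simp add: \<Gamma>_def)
      then have "finite G'" "G' \<noteq> {}" using G(2) by (auto simp: G'_def)
      moreover have "0 < a" if "(i, a) \<in> G'" for i a
        using that G \<delta> by (auto simp: G'_def \<Gamma>_def)
      ultimately show "\<exists>l. ((\<lambda>t. t * prob (\<Union>g\<in>G. E g t)) \<longlongrightarrow> l) at_top"
        using lim[of G'] by simp
    qed
    then obtain L where L: "((\<lambda>t. t * prob (B t)) \<longlongrightarrow> L) at_top" by (auto simp: B_def)
    have B_ev: "B t \<in> events" for t
    proof -
      have card: "real (card {g \<in> \<Gamma>. w \<in> E g t}) = (\<Sum>g\<in>\<Gamma>. indicator (E g t) w)" for w
        by (simp add: \<Gamma>_def indicator_def sum.If_cases Int_def)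
      have [measurable]: "E g t \<in> events" for g by (cases g) (simp add: E_def)
      show ?thesis unfolding B_def Q_def card by measurable
    qed
    have level: "real (card {g \<in> \<Gamma>. w \<in> E g t}) = (\<Sum>i\<in>UNIV. real (count_upto K (Z i w / (\<delta> * t))))"
      if "t > 0" "w \<in> space M" for t w
    proof -
      have "{g \<in> \<Gamma>. w \<in> E g t} = Sigma UNIV (\<lambda>i. {j \<in> {1..K}. real j \<le> Z i w / (\<delta> * t)})"
        using that \<delta> by (auto simp: \<Gamma>_def E_def field_simps)
      then show ?thesis by (simp add: count_upto_def)
    qed
    have sub1: "prob (B t) \<le> prob {w \<in> space M. t \<le> S w}" if t: "t > 0" for t
    proof (intro finite_measure_mono subsetI)
      fix w assume w: "w \<in> B t"
      then have wM: "w \<in> space M" by (simp add: B_def)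
      have "1 \<le> \<delta> * (\<Sum>i\<in>UNIV. real (count_upto K (Z i w / (\<delta> * t))))"
        using w level[OF t wM] by (simp add: B_def Q_def)
      also have "\<dots> \<le> \<delta> * (\<Sum>i\<in>UNIV. Z i w / (\<delta> * t))"
        using \<delta> t nonneg by (intro mult_left_mono sum_mono count_upto_le) auto
      also have "\<dots> = S w / t" using \<delta> by (simp add: S_def sum_divide_distrib[symmetric])
      finally show "w \<in> {w \<in> space M. t \<le> S w}" using t wM by (simp add: field_simps)
    qed auto
    have sub2: "prob {w \<in> space M. (1 + \<epsilon>) * t \<le> S w} \<le> prob (B t)" if t: "t > 0" for t
    proof (intro finite_measure_mono subsetI B_ev)
      fix w assume w: "w \<in> {w \<in> space M. (1 + \<epsilon>) * t \<le> S w}"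
      then have wM: "w \<in> space M" by simp
      have "1 \<le> \<delta> * (\<Sum>i\<in>UNIV. real (count_upto K (Z i w / (\<delta> * t))))"
      proof (cases "\<exists>i. real K \<le> Z i w / (\<delta> * t)")
        case True
        then obtain i where i: "real K \<le> Z i w / (\<delta> * t)" by auto
        have "1 \<le> \<delta> * real K" using K by (simp add: mult.commute)
        also have "real K = real (count_upto K (Z i w / (\<delta> * t)))"
          using i by (simp add: count_upto_full)
        also have "\<dots> \<le> (\<Sum>i\<in>UNIV. real (count_upto K (Z i w / (\<delta> * t))))"
          by (intro member_le_sum) auto
        finally show ?thesis using \<delta> by simp
      next
        case False
        have "Z i w / (\<delta> * t) - 1 \<le> real (count_upto K (Z i w / (\<delta> * t)))" for i
          using False nonneg[of i w] \<delta> t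
          by (intro count_upto_ge) (auto simp: not_le)
        then have "(\<Sum>i\<in>UNIV. Z i w / (\<delta> * t) - 1) \<le> (\<Sum>i\<in>UNIV. real (count_upto K (Z i w / (\<delta> * t))))"
          by (intro sum_mono)
        then have "\<delta> * (S w / (\<delta> * t) - n) \<le> \<delta> * (\<Sum>i\<in>UNIV. real (count_upto K (Z i w / (\<delta> * t))))"
          using \<delta> by (simp add: sum_subtractf S_def n_def sum_divide_distrib)
        moreover have "\<delta> * (S w / (\<delta> * t) - n) = S w / t - \<epsilon>"
          using \<delta> by (simp add: right_diff_distrib mult.commute)
        moreover have "S w / t \<ge> 1 + \<epsilon>" using w t by (simp add: field_simps)
        ultimately show ?thesis by linarith
      qed
      then show "w \<in> B t" using level[OF t wM] wM by (simp add: B_def Q_def)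
    qed
    have "eventually (\<lambda>t. L - \<epsilon> < t * prob (B t)) at_top"
      using \<epsilon> by (intro order_tendstoD(1)[OF L]) simp
    then have 1: "eventually (\<lambda>t. L - \<epsilon> \<le> g t) at_top"
      using eventually_gt_at_top[of 0]
    proof eventually_elim
      case (elim t)
      then have "t * prob (B t) \<le> g t" unfolding g_def by (intro mult_left_mono sub1) auto
      then show ?case using elim by linarith
    qed
    have "eventually (\<lambda>t. t * prob (B t) < L + \<epsilon>) at_top"
      using \<epsilon> by (intro order_tendstoD(2)[OF L]) simp
    then have "eventually (\<lambda>t. g ((1 + \<epsilon>) * t) \<le> (1 + \<epsilon>) * (L + \<epsilon>)) at_top"
      using eventually_gt_at_top[of 0]
    proof eventually_elim
      case (elim t)
      have "g ((1 + \<epsilon>) * t) = (1 + \<epsilon>) * (t * prob {w \<in> space M. (1 + \<epsilon>) * t \<le> S w})"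
        by (simp add: g_def)
      also have "\<dots> \<le> (1 + \<epsilon>) * (t * prob (B t))"
        using \<epsilon> elim by (intro mult_left_mono sub2) auto
      also have "\<dots> \<le> (1 + \<epsilon>) * (L + \<epsilon>)" using \<epsilon> elim by (intro mult_left_mono) auto
      finally show ?case .
    qed
    moreover have "filterlim (\<lambda>t. t / (1 + \<epsilon>)) at_top at_top"
      unfolding divide_inverse using \<epsilon>
      by (subst mult.commute, intro filterlim_tendsto_pos_mult_at_top[OF tendsto_const]) (auto intro: filterlim_ident)
    ultimately have "eventually (\<lambda>t. g ((1 + \<epsilon>) * (t / (1 + \<epsilon>))) \<le> (1 + \<epsilon>) * (L + \<epsilon>)) at_top"
      by (rule eventually_compose_filterlim)
    then have "eventually (\<lambda>t. g t \<le> (1 + \<epsilon>) * (L + \<epsilon>)) at_top" using \<epsilon> by simp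
    with 1 show ?thesis by blast
  qed

  have "(g \<longlongrightarrow> 1) at_top"
  proof (rule tendstoI)
    fix e :: real assume e: "e > 0"
    define \<epsilon> where "\<epsilon> = min 1 (e / 6)"
    have \<epsilon>: "0 < \<epsilon>" "\<epsilon> \<le> 1" "6 * \<epsilon> \<le> e" using e by (auto simp: \<epsilon>_def)
    obtain L where L: "eventually (\<lambda>t. L - \<epsilon> \<le> g t) at_top"
         "eventually (\<lambda>t. g t \<le> (1 + \<epsilon>) * (L + \<epsilon>)) at_top"
      using squeeze[OF \<epsilon>(1)] by blast
    have 1: "L \<le> 1 + \<epsilon>" using lower[OF L(1)] by simp
    have 2: "1 \<le> (1 + \<epsilon>) * (L + \<epsilon>)" using upper[OF L(2)] .
    have "(1 + \<epsilon>) * (1 - \<epsilon>) \<le> 1" by (simp add: algebra_simps)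
    also note 2
    finally have 3: "1 - \<epsilon> \<le> L + \<epsilon>" using \<epsilon> by (simp add: mult_le_cancel_left)
    have "(1 + \<epsilon>) * (L + \<epsilon>) \<le> (1 + \<epsilon>) * (1 + 2 * \<epsilon>)"
      using 1 \<epsilon> by (intro mult_left_mono) auto
    also have "\<dots> = 1 + 3 * \<epsilon> + 2 * (\<epsilon> * \<epsilon>)" by (simp add: algebra_simps)
    also have "\<epsilon> * \<epsilon> \<le> \<epsilon>" using \<epsilon> by (simp add: mult_left_le)
    finally have 4: "(1 + \<epsilon>) * (L + \<epsilon>) < 1 + e" using \<epsilon> by linarith
    show "eventually (\<lambda>t. dist (g t) 1 < e) at_top"
      using L
    proof eventually_elim
      case (elim t)
      have "g t < 1 + e" using elim 4 by linarith
      moreover have "g t > 1 - e" using elim 3 \<epsilon> by linarith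
      ultimately show ?case by (simp add: dist_real_def abs_less_iff)
    qed
  qed
  then show ?thesis unfolding g_def[abs_def] S_def .
qed

section \<open>Quantiles of a regularly varying distribution function\<close>

lemma is_cdfD:
  assumes "is_cdf F"
  shows "x \<le> y \<Longrightarrow> F x \<le> F y" "0 \<le> F x" "F x \<le> 1" "continuous (at_right x) F"
    "(F \<longlongrightarrow> 0) at_bot" "(F \<longlongrightarrow> 1) at_top"
proof -
  obtain N where N: "real_distribution N" "F = cdf N" using assms by (auto simp: is_cdf_def)
  interpret real_distribution N by (rule N)
  show "x \<le> y \<Longrightarrow> F x \<le> F y" "0 \<le> F x" "F x \<le> 1" "continuous (at_right x) F"
    "(F \<longlongrightarrow> 0) at_bot" "(F \<longlongrightarrow> 1) at_top"
    using cdf_nondecreasing cdf_nonneg cdf_bounded_prob cdf_is_right_cont cdf_lim_at_bot cdf_lim_at_top_prob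
    by (auto simp: N(2))
qed

lemma quantile_le_iff:
  assumes F: "is_cdf F" and t: "0 < t" "t < 1"
  shows "quantile F t \<le> y \<longleftrightarrow> t \<le> F y"
proof -
  define A where "A = {x. t \<le> F x}"
  have q: "quantile F t = Inf A" using t by (simp add: quantile_def A_def)
  have "eventually (\<lambda>x. t < F x) at_top" using is_cdfD(6)[OF F] t by (intro order_tendstoD) auto
  then have ne: "A \<noteq> {}"
    by (auto simp: A_def eventually_at_top_linorder intro: less_imp_le)
  have "eventually (\<lambda>x. F x < t) at_bot" using is_cdfD(5)[OF F] t by (intro order_tendstoD) auto
  then obtain b where b: "\<And>x. x \<le> b \<Longrightarrow> F x < t" by (auto simp: eventually_at_bot_linorder)
  have bdd: "bdd_below A"
  proof (rule bdd_belowI)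
    fix x assume "x \<in> A"
    then show "b \<le> x" using b[of x] by (cases "x \<le> b") (auto simp: A_def)
  qed
  have "t \<le> F (Inf A)"
  proof (rule ccontr)
    assume n: "\<not> t \<le> F (Inf A)"
    have "(F \<longlongrightarrow> F (Inf A)) (at_right (Inf A))"
      using is_cdfD(4)[OF F] by (simp add: continuous_within)
    then have "eventually (\<lambda>x. F x < t) (at_right (Inf A))"
      using n by (intro order_tendstoD) auto
    then obtain b where b: "b > Inf A" "\<And>x. Inf A < x \<Longrightarrow> x < b \<Longrightarrow> F x < t"
      by (auto simp: eventually_at_right_field)
    obtain a where a: "a \<in> A" "a < b" using cInf_lessD[OF ne b(1)] by auto
    have "Inf A \<le> a" using a bdd by (simp add: cInf_lower)
    then show False using a b(2)[of a] n by (cases "a = Inf A") (auto simp: A_def)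
  qed
  then have "t \<le> F y" if "Inf A \<le> y" using is_cdfD(1)[OF F that] by linarith
  moreover have "Inf A \<le> y" if "t \<le> F y" using bdd that by (intro cInf_lower) (auto simp: A_def)
  ultimately show ?thesis unfolding q by blast
qed

text \<open>
  The quantile at level \<open>F x\<close> is always a point of the support, which yields the
  contradiction when \<open>0 < F x\<close> and \<open>x\<close> lies below the support.
\<close>

lemma cdf_eq_0_below_support:
  assumes F: "is_cdf F" and sup: "cdf_support F = {c..}" and x: "x < c" and lt: "F x < 1"
  shows "F x = 0"
proof (rule ccontr)
  assume "F x \<noteq> 0"
  then have t: "0 < F x" using is_cdfD(2)[OF F, of x] by linarith
  define y where "y = quantile F (F x)"
  have y: "y \<le> z \<longleftrightarrow> F x \<le> F z" for z unfolding y_def by (rule quantile_le_iff[OF F t lt])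
  have "F (y - e) < F (y + e)" if "e > 0" for e
    using y[of "y - e"] y[of "y + e"] that by simp
  then have "y \<in> {c..}" unfolding sup[symmetric] by (simp add: cdf_support_def)
  then show False using y[of x] x by simp
qed

lemma reg_varying_cdf_starE:
  assumes "reg_varying_cdf_star \<gamma> F"
  obtains c where "is_cdf F" "cdf_support F = {c..}" "continuous_on {c..} F"
    "strict_mono_on {c..} F" "\<And>x. F x < 1" "\<And>x. x < c \<Longrightarrow> F x = 0"
proof -
  obtain c where c: "is_cdf F" "cdf_support F = {c..}" "continuous_on {c..} F"
    "strict_mono_on {c..} F"
    using assms by (auto simp: reg_varying_cdf_star_def reg_varying_cdf_def)
  have lt: "F x < 1" for x
  proof -
    have "F x \<le> F (max x c)" using is_cdfD(1)[OF c(1)] by simp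
    also have "\<dots> < F (max x c + 1)" by (intro strict_mono_onD[OF c(4)]) auto
    also have "\<dots> \<le> 1" by (rule is_cdfD(3)[OF c(1)])
    finally show ?thesis .
  qed
  show ?thesis
    using that[OF c lt] cdf_eq_0_below_support[OF c(1,2) _ lt] by blast
qed

text \<open>
  From \<open>1\<close> on the quantile is the constant \<open>Inf {}\<close>, whose value is irrelevant
  for measurability.
\<close>

lemma borel_measurable_quantile:
  assumes "reg_varying_cdf_star \<gamma> F"
  shows "(\<lambda>t. quantile F (max 0 t)) \<in> borel_measurable borel"
proof -
  obtain c where c: "is_cdf F" "\<And>x. F x < 1" using reg_varying_cdf_starE[OF assms] by metis
  have one: "quantile F t = Inf {}" if "t \<ge> 1" for t
  proof -
    have "F x < t" for x using c(2)[of x] that by linarith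
    then have "{x. t \<le> F x} = {}" by (auto simp: not_le)
    then show ?thesis using that by (simp add: quantile_def)
  qed
  have "{t. quantile F (max 0 t) \<le> y} =
      {t. t \<le> 0 \<and> quantile F 0 \<le> y} \<union> {t. 0 < t \<and> t < 1 \<and> t \<le> F y} \<union>
      {t. 1 \<le> t \<and> Inf {} \<le> y}" (is "_ = ?R") for y
  proof (intro set_eqI)
    fix t :: real
    consider "t \<le> 0" | "0 < t" "t < 1" | "t \<ge> 1" by linarith
    then show "t \<in> {t. quantile F (max 0 t) \<le> y} \<longleftrightarrow> t \<in> ?R"
      by cases (auto simp: max_def quantile_le_iff[OF c(1)] one)
  qed
  then show ?thesis by (intro borel_measurableI_le) auto
qed

lemma quantile_pareto_le_iff:
  assumes F: "is_cdf F" "cdf_support F = {c..}" and z: "0 < z" and y: "c \<le> y"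
  shows "quantile F (max 0 (1 - 1 / z)) \<le> y \<longleftrightarrow> z * (1 - F y) \<le> 1"
proof (cases "z \<le> 1")
  case True
  then have "1 - 1 / z \<le> 0" using z by simp
  then have "quantile F (max 0 (1 - 1 / z)) = c" using F(2) by (simp add: quantile_def max_def)
  moreover have "z * (1 - F y) \<le> 1"
    using True z is_cdfD(2,3)[OF F(1), of y] by (intro mult_le_one) auto
  ultimately show ?thesis using y by simp
next
  case False
  then have "quantile F (max 0 (1 - 1 / z)) \<le> y \<longleftrightarrow> 1 - 1 / z \<le> F y"
    by (simp add: quantile_le_iff[OF F(1)])
  also have "\<dots> \<longleftrightarrow> z * (1 - F y) \<le> 1" using z by (simp add: field_simps)
  finally show ?thesis .
qed

lemma quantile_pareto_ge:
  assumes F: "is_cdf F" "cdf_support F = {c..}" "\<And>x. x < c \<Longrightarrow> F x = 0" and z: "0 < z"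
  shows "c \<le> quantile F (max 0 (1 - 1 / z))"
proof (cases "z \<le> 1")
  case True
  then have "1 - 1 / z \<le> 0" using z by simp
  then show ?thesis using F(2) by (simp add: quantile_def max_def)
next
  case False
  then have "\<not> quantile F (max 0 (1 - 1 / z)) \<le> x" if "x < c" for x
    using F(3)[OF that] by (simp add: quantile_le_iff[OF F(1)])
  then show ?thesis by (meson not_le order_refl)
qed

text \<open>
  The quantile at level \<open>1 - 1 / z\<close> compares with \<open>q\<close> as \<open>z\<close> does with \<open>1 / (1 - F q)\<close>, uniformly
  in \<open>z\<close>. Regular variation gives the comparison on a finite grid of multiples of \<open>q\<close>;
  monotonicity fills the gaps, as in the theorem that pointwise convergence of monotone
  functions to a continuous limit is uniform on compact sets. The truncation at \<open>M\<close> in the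
  lower bound extends it to all \<open>z\<close>.
\<close>

lemma quantile_asymp_uniform:
  assumes F: "reg_varying_cdf_star 1 F" and \<eta>: "0 < \<eta>" and M: "0 \<le> M"
  shows "eventually (\<lambda>q. \<forall>z>0.
     ((1 - F q) * z \<le> M \<longrightarrow>
        quantile F (max 0 (1 - 1 / z)) \<le> q * ((1 - F q) * z + \<eta>)) \<and>
     q * (min ((1 - F q) * z) M - \<eta>) \<le> quantile F (max 0 (1 - 1 / z))) at_top"
proof -
  obtain c where c: "is_cdf F" "cdf_support F = {c..}" "\<And>x. F x < 1" "\<And>x. x < c \<Longrightarrow> F x = 0"
    using reg_varying_cdf_starE[OF F] by metis
  define \<delta> where "\<delta> = \<eta> / 3"
  have \<delta>: "\<delta> > 0" "\<eta> = 3 * \<delta>" using \<eta> by (auto simp: \<delta>_def)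
  define K where "K = nat \<lceil>M / \<delta>\<rceil> + 1"
  have lim: "((\<lambda>q. (1 - F q) / (1 - F (q * y))) \<longlongrightarrow> y) at_top" if "y > 0" for y
  proof -
    have "((\<lambda>q. (1 - F (q * y)) / (1 - F q)) \<longlongrightarrow> y powr - 1) at_top"
      using F that by (simp add: reg_varying_cdf_star_def reg_varying_cdf_def survival_def)
    then have "((\<lambda>q. inverse ((1 - F (q * y)) / (1 - F q))) \<longlongrightarrow> inverse (y powr - 1)) at_top"
      using that by (intro tendsto_inverse) auto
    then show ?thesis using that by (simp add: powr_minus)
  qed
  have "eventually (\<lambda>q. \<forall>k\<in>{1..K}. dist ((1 - F q) / (1 - F (q * (real k * \<delta>)))) (real k * \<delta>) < \<delta>) at_top"
    using \<delta> by (intro eventually_ball_finite ballI tendstoD lim) auto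
  moreover have "eventually (\<lambda>q. q \<ge> \<bar>c\<bar> / \<delta>) at_top" by (rule eventually_ge_at_top)
  ultimately show ?thesis using eventually_gt_at_top[of 0]
  proof eventually_elim
    case (elim q)
    define \<alpha> where "\<alpha> = 1 - F q"
    have q: "q > 0" "\<bar>c\<bar> \<le> q * \<delta>" using elim \<delta> by (auto simp: pos_divide_le_eq)
    have \<alpha>: "\<alpha> > 0" using c(3)[of q] by (simp add: \<alpha>_def)
    have grid: "\<alpha> / (1 - F (q * (real k * \<delta>))) \<ge> (real k - 1) * \<delta>"
      "\<alpha> / (1 - F (q * (real k * \<delta>))) \<le> (real k + 1) * \<delta>"
      "c \<le> q * (real k * \<delta>)" if "1 \<le> k" "k \<le> K" for k
    proof -
      have "dist (\<alpha> / (1 - F (q * (real k * \<delta>)))) (real k * \<delta>) < \<delta>"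
        using elim(1) that by (auto simp: \<alpha>_def)
      then show "\<alpha> / (1 - F (q * (real k * \<delta>))) \<ge> (real k - 1) * \<delta>"
        "\<alpha> / (1 - F (q * (real k * \<delta>))) \<le> (real k + 1) * \<delta>"
        by (simp_all add: dist_real_def abs_less_iff algebra_simps)
      have "q * \<delta> \<le> real k * (q * \<delta>)" using that q \<delta> by simp
      then show "c \<le> q * (real k * \<delta>)" using q by (simp add: mult_ac)
    qed
    show ?case
    proof (intro allI impI conjI)
      fix z :: real assume z: "z > 0"
      define x where "x = quantile F (max 0 (1 - 1 / z))"
      have cmp: "x \<le> y \<longleftrightarrow> \<alpha> * z \<le> \<alpha> / (1 - F y)" if "c \<le> y" for y
      proof -
        have "x \<le> y \<longleftrightarrow> z * (1 - F y) \<le> 1"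
          unfolding x_def by (rule quantile_pareto_le_iff[OF c(1,2) z that])
        also have "\<dots> \<longleftrightarrow> \<alpha> * z \<le> \<alpha> / (1 - F y)"
          using c(3)[of y] \<alpha> by (simp add: pos_le_divide_eq)
        finally show ?thesis .
      qed
      {
        assume zM: "(1 - F q) * z \<le> M"
        define k where "k = nat \<lceil>\<alpha> * z / \<delta>\<rceil> + 1"
        have "\<alpha> * z / \<delta> \<le> M / \<delta>" using zM \<delta> by (simp add: \<alpha>_def divide_right_mono)
        then have "nat \<lceil>\<alpha> * z / \<delta>\<rceil> \<le> nat \<lceil>M / \<delta>\<rceil>" by (intro nat_mono ceiling_mono)
        then have k: "1 \<le> k" "k \<le> K" unfolding k_def K_def by simp_all
        have "0 \<le> \<alpha> * z / \<delta>" using \<alpha> z \<delta> by simp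
        then have kk: "real k - 1 = of_int \<lceil>\<alpha> * z / \<delta>\<rceil>" unfolding k_def by simp
        have "\<alpha> * z / \<delta> \<le> real k - 1" "real k \<le> \<alpha> * z / \<delta> + 2" using kk by linarith+
        then have k': "\<alpha> * z \<le> (real k - 1) * \<delta>" "real k * \<delta> \<le> \<alpha> * z + 2 * \<delta>"
          using \<delta> by (simp_all add: field_simps)
        have "x \<le> q * (real k * \<delta>)" using grid[OF k] k' by (subst cmp) auto
        also have "\<dots> \<le> q * (\<alpha> * z + \<eta>)"
          using q k' \<delta> by (intro mult_left_mono) auto
        finally show "quantile F (max 0 (1 - 1 / z)) \<le> q * ((1 - F q) * z + \<eta>)"
          by (simp add: x_def \<alpha>_def)
      }
      define m where "m = min (\<alpha> * z) M"
      have "q * (m - \<eta>) \<le> x"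
      proof (cases "m \<le> 2 * \<delta>")
        case True
        then have "q * (m - \<eta>) \<le> q * (- \<delta>)" using q \<delta> by (intro mult_left_mono) auto
        also have "\<dots> \<le> c" using q by simp
        also have "c \<le> x" unfolding x_def by (rule quantile_pareto_ge[OF c(1,2,4) z])
        finally show ?thesis .
      next
        case False
        define k where "k = nat (\<lceil>m / \<delta>\<rceil> - 2)"
        have "m / \<delta> > 2" using False \<delta> by (simp add: field_simps)
        then have ge: "\<lceil>m / \<delta>\<rceil> \<ge> 3" by linarith
        have "m / \<delta> \<le> M / \<delta>" using \<delta> by (simp add: m_def divide_right_mono)
        then have "\<lceil>m / \<delta>\<rceil> \<le> \<lceil>M / \<delta>\<rceil>" by (rule ceiling_mono)
        then have k: "1 \<le> k" "k \<le> K" using ge unfolding k_def K_def by linarith+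
        have kk: "real k = of_int \<lceil>m / \<delta>\<rceil> - 2" using ge by (simp add: k_def)
        have "real k + 1 < m / \<delta>" "m / \<delta> - 2 \<le> real k" using kk by linarith+
        then have k': "(real k + 1) * \<delta> < m" "m - 2 * \<delta> \<le> real k * \<delta>"
          using \<delta> by (simp_all add: field_simps)
        have "m \<le> \<alpha> * z" by (simp add: m_def)
        then have "\<not> x \<le> q * (real k * \<delta>)"
          using grid[OF k] k' by (subst cmp) auto
        moreover have "q * (m - \<eta>) \<le> q * (real k * \<delta>)"
          using q k' \<delta> by (intro mult_left_mono) auto
        ultimately show ?thesis by linarith
      qed
      then show "q * (min ((1 - F q) * z) M - \<eta>) \<le> quantile F (max 0 (1 - 1 / z))"
        by (simp add: x_def m_def \<alpha>_def)
    qed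
  qed
qed

text \<open>
  A deterministic comparison: with \<open>z\<^sub>i = \<omega>\<^sub>i / p\<^sub>i\<close>, the function \<open>T\<close> is the statistic of the
  weighted combination test. A single large \<open>z\<^sub>i\<close> is harmless in the first
  implication because the truncation level \<open>M = n (1 + \<epsilon>)\<close> alone already makes the sum large enough.
\<close>

lemma mean_quantile_comparison:
  fixes F :: "real \<Rightarrow> real" and \<epsilon> :: real
  defines "T \<equiv> \<lambda>z :: 'n::finite \<Rightarrow> real.
             (1 / real CARD('n)) * (\<Sum>i\<in>UNIV. quantile F (max 0 (1 - 1 / z i)))"
  assumes F: "reg_varying_cdf_star 1 F" and \<epsilon>: "0 < \<epsilon>"
  shows "eventually (\<lambda>\<alpha>. \<forall>z. (\<forall>i. 0 < z i) \<longrightarrow>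
     ((1 + \<epsilon>) / \<alpha> \<le> (\<Sum>i\<in>UNIV. z i) / real CARD('n) \<longrightarrow> 1 - F (T z) \<le> \<alpha>) \<and>
     (1 - F (T z) \<le> \<alpha> \<longrightarrow> (1 - \<epsilon>) / \<alpha> \<le> (\<Sum>i\<in>UNIV. z i) / real CARD('n))) (at_right 0)"
proof -
  obtain c where c: "is_cdf F" "cdf_support F = {c..}" "continuous_on {c..} F"
    "strict_mono_on {c..} F" "\<And>x. F x < 1" 
    using reg_varying_cdf_starE[OF F] by metis
  define n where "n = real CARD('n)"
  have n: "n \<ge> 1" by (simp add: n_def Suc_leI)
  define M where "M = n * (1 + \<epsilon>)"
  define \<eta> where "\<eta> = \<epsilon> / 2"
  define X where "X z = quantile F (max 0 (1 - 1 / z))" for z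
  have T: "T z = (\<Sum>i\<in>UNIV. X (z i)) / n" for z by (simp add: T_def X_def n_def)
  have "eventually (\<lambda>q. \<forall>z>0.
     ((1 - F q) * z \<le> M \<longrightarrow> X z \<le> q * ((1 - F q) * z + \<eta>)) \<and>
     q * (min ((1 - F q) * z) M - \<eta>) \<le> X z) at_top"
    unfolding X_def by (rule quantile_asymp_uniform[OF F]) (use \<epsilon> n in \<open>auto simp: M_def \<eta>_def\<close>)
  then obtain q0 where q0: "\<And>q z. q0 \<le> q \<Longrightarrow> z > 0 \<Longrightarrow>
     ((1 - F q) * z \<le> M \<longrightarrow> X z \<le> q * ((1 - F q) * z + \<eta>)) \<and>
     q * (min ((1 - F q) * z) M - \<eta>) \<le> X z"
    unfolding eventually_at_top_linorder by blast
  define q1 where "q1 = max q0 (max c 0 + 1)"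
  have q1: "q1 \<ge> q0" "q1 > c" "q1 > 0" by (auto simp: q1_def)
  have "eventually (\<lambda>\<alpha>. 0 < \<alpha> \<and> \<alpha> < 1 - F q1) (at_right 0)"
    using c(5)[of q1] by (intro eventually_at_rightI[of 0 "1 - F q1"]) auto
  then show ?thesis
  proof eventually_elim
    case (elim \<alpha>)
    have "eventually (\<lambda>x. 1 - \<alpha> < F x) at_top"
      using is_cdfD(6)[OF c(1)] elim by (intro order_tendstoD) auto
    then obtain q2 where "\<And>x. x \<ge> q2 \<Longrightarrow> 1 - \<alpha> < F x" by (auto simp: eventually_at_top_linorder)
    then have "1 - \<alpha> \<le> F (max q1 q2)" by (simp add: less_imp_le)
    moreover have "continuous_on {q1..max q1 q2} F"
      by (rule continuous_on_subset[OF c(3)]) (use q1 in auto)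
    ultimately obtain q where q: "q1 \<le> q" "F q = 1 - \<alpha>"
      using IVT'[of F q1 "1 - \<alpha>" "max q1 q2"] elim by auto
    have \<alpha>: "\<alpha> = 1 - F q" "\<alpha> > 0" using q elim by auto
    have q_pos: "q > 0" "q > c" "q \<ge> q0" using q q1 by linarith+
    show ?case
    proof (intro allI impI conjI)
      fix z :: "'n \<Rightarrow> real" assume z: "\<forall>i. 0 < z i"
      assume "(1 + \<epsilon>) / \<alpha> \<le> (\<Sum>i\<in>UNIV. z i) / real CARD('n)"
      then have "(1 + \<epsilon>) / \<alpha> * (\<alpha> * n) \<le> (\<Sum>i\<in>UNIV. z i) / n * (\<alpha> * n)"
        using \<alpha>(2) n unfolding n_def[symmetric] by (intro mult_right_mono) auto
      then have big: "M \<le> (\<Sum>i\<in>UNIV. \<alpha> * z i)"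
        using \<alpha>(2) n unfolding M_def sum_distrib_left[symmetric] by (simp add: mult.commute)
      have min_big: "M \<le> (\<Sum>i\<in>UNIV. min (\<alpha> * z i) M)"
      proof (cases "\<exists>i. M \<le> \<alpha> * z i")
        case True
        then obtain i where "M \<le> \<alpha> * z i" by auto
        then have "M = min (\<alpha> * z i) M" by simp
        also have "\<dots> \<le> (\<Sum>i\<in>UNIV. min (\<alpha> * z i) M)"
          using z \<alpha> n \<epsilon> by (intro member_le_sum) (auto simp: M_def less_imp_le)
        finally show ?thesis .
      next
        case False
        then have "min (\<alpha> * z i) M = \<alpha> * z i" for i by (auto simp: not_le min_def less_imp_le)
        then show ?thesis using big by simp
      qed
      have "n * q \<le> q * (\<Sum>i\<in>(UNIV::'n set). min (\<alpha> * z i) M - \<eta>)"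
      proof -
        have "n \<le> M - n * \<eta>" using n \<epsilon> by (simp add: M_def \<eta>_def algebra_simps)
        also have "\<dots> \<le> (\<Sum>i\<in>(UNIV::'n set). min (\<alpha> * z i) M - \<eta>)"
          using min_big by (simp add: sum_subtractf n_def)
        finally show ?thesis using q_pos by (simp add: mult.commute)
      qed
      also have "\<dots> \<le> (\<Sum>i\<in>UNIV. X (z i))"
        unfolding sum_distrib_left
        using q0[OF q_pos(3)] z by (intro sum_mono) (simp add: \<alpha>(1))
      finally have "q \<le> T z" using n by (simp add: T pos_le_divide_eq pos_divide_less_eq mult.commute)
      then show "1 - F (T z) \<le> \<alpha>" using is_cdfD(1)[OF c(1)] \<alpha> by simp
    next
      fix z :: "'n \<Rightarrow> real" assume z: "\<forall>i. 0 < z i"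
      assume small: "1 - F (T z) \<le> \<alpha>"
      show "(1 - \<epsilon>) / \<alpha> \<le> (\<Sum>i\<in>UNIV. z i) / real CARD('n)"
      proof (rule ccontr)
        assume "\<not> (1 - \<epsilon>) / \<alpha> \<le> (\<Sum>i\<in>UNIV. z i) / real CARD('n)"
        then have "(\<Sum>i\<in>UNIV. z i) / n * (\<alpha> * n) < (1 - \<epsilon>) / \<alpha> * (\<alpha> * n)"
          using \<alpha>(2) n unfolding n_def[symmetric] by (intro mult_strict_right_mono) auto
        then have sm: "(\<Sum>i\<in>UNIV. \<alpha> * z i) < n * (1 - \<epsilon>)"
          using \<alpha>(2) n unfolding sum_distrib_left[symmetric] by (simp add: mult.commute)
        have "\<alpha> * z i \<le> M" for i
        proof -
          have "\<alpha> * z i \<le> (\<Sum>i\<in>UNIV. \<alpha> * z i)"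
            using z \<alpha> by (intro member_le_sum) (auto simp: less_imp_le)
          also note sm
          also have "n * (1 - \<epsilon>) \<le> M" using n \<epsilon> by (simp add: M_def)
          finally show ?thesis by simp
        qed
        then have "(\<Sum>i\<in>UNIV. X (z i)) \<le> q * (\<Sum>i\<in>(UNIV::'n set). \<alpha> * z i + \<eta>)"
          unfolding sum_distrib_left
        using q0[OF q_pos(3)] z by (intro sum_mono) (simp add: \<alpha>(1))
        also have "(\<Sum>i\<in>(UNIV::'n set). \<alpha> * z i + \<eta>) = (\<Sum>i\<in>UNIV. \<alpha> * z i) + n * \<eta>"
          by (simp add: sum.distrib n_def)
        also have "q * \<dots> < q * n"
        proof -
          have "n * \<eta> \<le> n * \<epsilon>" using n \<epsilon> by (simp add: \<eta>_def)
          then have "(\<Sum>i\<in>UNIV. \<alpha> * z i) + n * \<eta> < n" using sm by (simp add: algebra_simps)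
          then show ?thesis using q_pos by simp
        qed
        finally have "T z < q" using n by (simp add: T pos_le_divide_eq pos_divide_less_eq mult.commute)
        then have "max (T z) c < q" using q_pos by simp
        then have "F (max (T z) c) < F q"
          using q_pos by (intro strict_mono_onD[OF c(4)]) auto
        moreover have "F (T z) \<le> F (max (T z) c)" by (intro is_cdfD(1)[OF c(1)]) simp
        ultimately show False using small \<alpha> by simp
      qed
    qed
  qed
qed

section \<open>Vectors of p-values with a multivariate tail limit\<close>

lemma borel_measurable_component:
  "(\<lambda>x :: real ^ 'n. x $ i) \<in> borel_measurable borel"
  by (intro borel_measurable_continuous_onI continuous_intros)

lemma copula_marginal:
  fixes C :: "real ^ 'n \<Rightarrow> real"
  assumes "copula C" and s: "0 \<le> s" "s \<le> 1"
  shows "C (\<chi> j. if j = i then s else 1) = s"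
proof -
  obtain N :: "(real ^ 'n) measure" where N: "prob_space N" "sets N = sets borel"
    "\<And>i. distr N borel (\<lambda>x. x $ i) = uniform_measure lborel {0..1}"
    "\<And>u. u \<in> unit_cube \<Longrightarrow> C u = joint_cdf N (\<lambda>x. x) u"
    using assms by (auto simp: copula_def)
  interpret N: prob_space N by (rule N)
  note [measurable_cong] = N(2)
  have spN: "space N = UNIV" using sets_eq_imp_space_eq[OF N(2)] by simp
  have comp [measurable]: "(\<lambda>x. x $ j) \<in> borel_measurable N" for j by measurable
  have marg: "N.prob {x \<in> space N. x $ j \<le> r} = r" if r: "0 \<le> r" "r \<le> 1" for j r
  proof -
    have "N.prob {x \<in> space N. x $ j \<le> r} = measure (distr N borel (\<lambda>x. x $ j)) {..r}"
      by (subst measure_distr) (auto simp: spN intro!: arg_cong[where f=N.prob])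
    also have "\<dots> = measure lborel ({0..1::real} \<inter> {..r}) / measure lborel {0..1::real}"
      unfolding N(3) by (subst measure_uniform_measure) auto
    also have "{0..1::real} \<inter> {..r} = {0..r}" using r by auto
    finally show ?thesis using r by simp
  qed
  have "AE x in N. x $ j \<le> 1" for j
    using N.prob_eq_1[of "{x \<in> space N. x $ j \<le> 1}"] marg[of 1 j] by simp
  then have ae: "AE x in N. \<forall>j. x $ j \<le> 1" by (simp add: AE_all_countable)
  have "C (\<chi> j. if j = i then s else 1)
      = N.prob {x \<in> space N. \<forall>j. x $ j \<le> (if j = i then s else 1)}"
    using s by (subst N(4)) (auto simp: unit_cube_def joint_cdf_def)
  also have "\<dots> = N.prob {x \<in> space N. x $ i \<le> s}"
  proof (rule N.finite_measure_eq_AE)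
    show "AE x in N. x \<in> {x \<in> space N. \<forall>j. x $ j \<le> (if j = i then s else 1)}
        \<longleftrightarrow> x \<in> {x \<in> space N. x $ i \<le> s}"
      using ae by eventually_elim (auto split: if_splits)
  qed measurable
  also have "\<dots> = s" by (rule marg[OF s])
  finally show ?thesis .
qed

text \<open>
  The consequences of the MRV copula assumption that the asymptotics use: positive,
  standard uniform p-values and the limit \<open>l\<close> of the scaled probability that some
  p-value is small. Only the values of \<open>l\<close> at vectors with nonnegative entries matter.
\<close>

locale tail_dependent_pvalues = prob_space M for M :: "'a measure" +
  fixes P :: "'a \<Rightarrow> real ^ 'n" and l :: "real ^ 'n \<Rightarrow> real"
  assumes P_measurable [measurable]: "P \<in> borel_measurable M"
    and P_pos: "AE w in M. \<forall>i. 0 < P w $ i"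
    and marginal: "0 \<le> s \<Longrightarrow> s \<le> 1 \<Longrightarrow> prob {w \<in> space M. P w $ i \<le> s} = s"
    and tail: "(\<And>i. 0 \<le> v $ i) \<Longrightarrow>
      ((\<lambda>s. prob {w \<in> space M. \<exists>i. P w $ i \<le> s * v $ i} / s) \<longlongrightarrow> l v) (at_right 0)"
begin

lemma P_component_measurable [measurable]: "(\<lambda>w. P w $ i) \<in> borel_measurable M"
  by (rule measurable_compose[OF P_measurable borel_measurable_component])

lemma tail_at_top:
  assumes "\<And>i. 0 \<le> v $ i"
  shows "((\<lambda>t. t * prob {w \<in> space M. \<exists>i. P w $ i \<le> v $ i / t}) \<longlongrightarrow> l v) at_top"
proof -
  have "((\<lambda>t. prob {w \<in> space M. \<exists>i. P w $ i \<le> inverse t * v $ i} / inverse t) \<longlongrightarrow> l v) at_top"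
    using tail[OF assms] unfolding filterlim_at_right_to_top .
  then show ?thesis by (simp add: divide_inverse mult.commute)
qed

lemma union_lipschitz:
  assumes "\<And>i. 0 \<le> b i" "\<And>i. b i \<le> a i" "\<And>i. a i \<le> 1"
  shows "prob {w \<in> space M. \<exists>i. P w $ i \<le> a i}
           \<le> prob {w \<in> space M. \<exists>i. P w $ i \<le> b i} + (\<Sum>i\<in>UNIV. a i - b i)"
proof -
  define D where "D i = {w \<in> space M. P w $ i \<le> a i} - {w \<in> space M. P w $ i \<le> b i}" for i
  have D_ev: "D i \<in> events" for i unfolding D_def by measurable
  have D_prob: "prob (D i) = a i - b i" for i
  proof -
    have "0 \<le> a i" "b i \<le> 1" using assms[of i] by (auto intro: order_trans)
    moreover have "{w \<in> space M. P w $ i \<le> b i} \<subseteq> {w \<in> space M. P w $ i \<le> a i}"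
      using assms(2)[of i] by auto
    then have "prob (D i) = prob {w \<in> space M. P w $ i \<le> a i} - prob {w \<in> space M. P w $ i \<le> b i}"
      unfolding D_def by (intro finite_measure_Diff) auto
    ultimately show ?thesis using assms by (simp add: marginal)
  qed
  have "prob {w \<in> space M. \<exists>i. P w $ i \<le> a i}
      \<le> prob ({w \<in> space M. \<exists>i. P w $ i \<le> b i} \<union> (\<Union>i\<in>UNIV. D i))"
    by (intro finite_measure_mono sets.Un sets.finite_UN D_ev) (auto simp: D_def)
  also have "\<dots> \<le> prob {w \<in> space M. \<exists>i. P w $ i \<le> b i} + prob (\<Union>i\<in>UNIV. D i)"
    by (intro measure_Un_le sets.finite_UN D_ev) auto
  also have "prob (\<Union>i\<in>UNIV. D i) \<le> (\<Sum>i\<in>UNIV. prob (D i))"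
    by (intro finite_measure_subadditive_finite) (use D_ev in auto)
  finally show ?thesis by (simp add: D_prob)
qed

text \<open>
  In particular \<open>l\<close> is positive at vectors with positive entries, so that the ratio of
  rejection rates has a finite limit.
\<close>

lemma tail_ge_component:
  assumes v: "\<And>i. 0 \<le> v $ i"
  shows "v $ i \<le> l v"
proof (rule tendsto_lowerbound[OF tail_at_top[OF v]])
  show "eventually (\<lambda>t. v $ i \<le> t * prob {w \<in> space M. \<exists>i. P w $ i \<le> v $ i / t}) at_top"
    using eventually_ge_at_top[of "max 1 (v $ i)"]
  proof eventually_elim
    case (elim t)
    have "v $ i = t * prob {w \<in> space M. P w $ i \<le> v $ i / t}"
      using elim v[of i] by (subst marginal) auto
    also have "\<dots> \<le> t * prob {w \<in> space M. \<exists>i. P w $ i \<le> v $ i / t}"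
      using elim by (intro mult_left_mono finite_measure_mono) auto
    finally show ?case .
  qed
qed simp

text \<open>
  The maximum with \<open>0\<close> only matters on the null set where some p-value is not positive.
\<close>

lemma weighted_sum_tail:
  assumes lam: "\<And>i. 0 < lam i" "(\<Sum>i\<in>UNIV. lam i) = 1"
  shows "((\<lambda>t. t * prob {w \<in> space M. t \<le> (\<Sum>i\<in>UNIV. max 0 (lam i / P w $ i))}) \<longlongrightarrow> 1) at_top"
proof (rule sum_tail_limit[where lam=lam])
  have lam_le: "lam i \<le> 1" for i
    unfolding lam(2)[symmetric] using lam(1) by (intro member_le_sum) (auto intro: less_imp_le)
  fix i and t :: real assume t: "1 \<le> t"
  have "prob {w \<in> space M. t \<le> max 0 (lam i / P w $ i)} = prob {w \<in> space M. P w $ i \<le> lam i / t}"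
  proof (intro finite_measure_eq_AE)
    show "AE w in M. w \<in> {w \<in> space M. t \<le> max 0 (lam i / P w $ i)}
        \<longleftrightarrow> w \<in> {w \<in> space M. P w $ i \<le> lam i / t}"
      using P_pos
    proof eventually_elim
      case (elim w)
      then have "0 < P w $ i" by auto
      then show ?case using t by (auto simp: field_simps le_max_iff_disj)
    qed
  qed auto
  also have "\<dots> = lam i / t"
    using t lam_le[of i] lam(1)[of i] by (intro marginal) (auto simp: divide_le_eq_1 less_imp_le)
  finally show "t * prob {w \<in> space M. t \<le> max 0 (lam i / P w $ i)} = lam i" using t by simp
next
  fix G :: "('n \<times> real) set"
  assume G: "finite G" "G \<noteq> {}" "\<And>i a. (i, a) \<in> G \<Longrightarrow> 0 < a"
  \<comment> \<open>The tail limit allows one threshold per coordinate; of several thresholds \<open>a\<close> for the same \<open>i\<close> the smallest decides.\<close>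
  define S where "S i = insert 0 ((\<lambda>(j, a). if j = i then lam i / a else 0) ` G)" for i
  define v :: "real ^ 'n" where "v = (\<chi> i. Max (S i))"
  have S: "finite (S i)" "S i \<noteq> {}" "0 \<in> S i" for i using G by (auto simp: S_def)
  have v0: "0 \<le> v $ i" for i using S by (simp add: v_def)
  have "eventually (\<lambda>t. t * prob {w \<in> space M. \<exists>i. P w $ i \<le> v $ i / t}
     = t * prob {w \<in> space M. \<exists>(i, a)\<in>G. a * t \<le> max 0 (lam i / P w $ i)}) at_top"
    using eventually_gt_at_top[of 0]
  proof eventually_elim
    case (elim t)
    have "prob {w \<in> space M. \<exists>i. P w $ i \<le> v $ i / t}
        = prob {w \<in> space M. \<exists>(i, a)\<in>G. a * t \<le> max 0 (lam i / P w $ i)}"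
    proof (intro finite_measure_eq_AE)
      show "AE w in M. w \<in> {w \<in> space M. \<exists>i. P w $ i \<le> v $ i / t}
          \<longleftrightarrow> w \<in> {w \<in> space M. \<exists>(i, a)\<in>G. a * t \<le> max 0 (lam i / P w $ i)}"
        using P_pos
      proof eventually_elim
        fix w assume pos: "\<forall>i. 0 < P w $ i"
        have "P w $ i \<le> v $ i / t \<longleftrightarrow> (\<exists>a. (i, a) \<in> G \<and> a * t \<le> max 0 (lam i / P w $ i))" for i
        proof -
          have pi: "0 < P w $ i" using pos by auto
          have "P w $ i \<le> v $ i / t \<longleftrightarrow> P w $ i * t \<le> Max (S i)"
            using elim by (simp add: v_def pos_le_divide_eq)
          also have "\<dots> \<longleftrightarrow> (\<exists>s\<in>S i. P w $ i * t \<le> s)" using S by (simp add: Max_ge_iff)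
          also have "\<dots> \<longleftrightarrow> (\<exists>a. (i, a) \<in> G \<and> P w $ i * t \<le> lam i / a)"
          proof -
            have "\<not> P w $ i * t \<le> 0" using pi elim by (simp add: not_le)
            then show ?thesis unfolding S_def by (auto split: if_splits) force
          qed
          also have "\<dots> \<longleftrightarrow> (\<exists>a. (i, a) \<in> G \<and> a * t \<le> max 0 (lam i / P w $ i))"
          proof -
            have "P w $ i * t \<le> lam i / a \<longleftrightarrow> a * t \<le> max 0 (lam i / P w $ i)"
              if "(i, a) \<in> G" for a
            proof -
              have "0 < a" "0 < a * t" using G(3)[OF that] elim by auto
              then show ?thesis using pi by (auto simp: field_simps le_max_iff_disj)
            qed
            then show ?thesis by blast
          qed
          finally show ?thesis .
        qed
        then show "w \<in> {w \<in> space M. \<exists>i. P w $ i \<le> v $ i / t}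
          \<longleftrightarrow> w \<in> {w \<in> space M. \<exists>(i, a)\<in>G. a * t \<le> max 0 (lam i / P w $ i)}"
          by blast
      qed
      show "{w \<in> space M. \<exists>(i, a)\<in>G. a * t \<le> max 0 (lam i / P w $ i)} \<in> events"
      proof -
        have "{w \<in> space M. \<exists>(i, a)\<in>G. a * t \<le> max 0 (lam i / P w $ i)}
          = (\<Union>g\<in>G. {w \<in> space M. snd g * t \<le> max 0 (lam (fst g) / P w $ fst g)})"
          by force
        also have "\<dots> \<in> events" using G by (intro sets.finite_UN) auto
        finally show ?thesis .
      qed
    qed auto
    then show ?case by simp
  qed
  from Lim_transform_eventually[OF tail_at_top[OF v0] this]
  show "\<exists>L. ((\<lambda>t. t * prob {w \<in> space M. \<exists>(i, a)\<in>G. a * t \<le> max 0 (lam i / P w $ i)}) \<longlongrightarrow> L) at_top"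
    by (rule exI)
qed (use lam in auto)

lemma bonferroni_rejection_rate:
  fixes \<omega> :: "real ^ 'n"
  assumes \<omega>: "\<And>i. 0 < \<omega> $ i"
  shows "((\<lambda>\<alpha>. prob {w \<in> space M. bonferroni_pvalue \<omega> (P w) \<le> \<alpha>} / \<alpha>)
           \<longlongrightarrow> l (\<chi> i. \<omega> $ i / real CARD('n))) (at_right 0)"
proof -
  have "((\<lambda>s. prob {w \<in> space M. \<exists>i. P w $ i \<le> s * (\<chi> i. \<omega> $ i / real CARD('n)) $ i} / s)
      \<longlongrightarrow> l (\<chi> i. \<omega> $ i / real CARD('n))) (at_right 0)"
    using \<omega> by (intro tail) (simp add: less_imp_le)
  moreover have "eventually (\<lambda>s.
      prob {w \<in> space M. \<exists>i. P w $ i \<le> s * (\<chi> i. \<omega> $ i / real CARD('n)) $ i} / s =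
      prob {w \<in> space M. bonferroni_pvalue \<omega> (P w) \<le> s} / s) (at_right 0)"
  proof (rule eventually_at_rightI[of 0 1])
    fix s :: real assume s: "s \<in> {0<..<1}"
    have "(\<exists>i. p $ i \<le> s * (\<omega> $ i / real CARD('n))) \<longleftrightarrow> bonferroni_pvalue \<omega> p \<le> s" for p :: "real ^ 'n"
    proof -
      have "bonferroni_pvalue \<omega> p \<le> s \<longleftrightarrow> (MIN i. p $ i / \<omega> $ i) \<le> s / real CARD('n)"
        using s by (auto simp: bonferroni_pvalue_def min_le_iff_disj field_simps)
      also have "\<dots> \<longleftrightarrow> (\<exists>i. p $ i / \<omega> $ i \<le> s / real CARD('n))" by (simp add: Min_le_iff)
      also have "\<dots> \<longleftrightarrow> (\<exists>i. p $ i \<le> s * (\<omega> $ i / real CARD('n)))"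
        using \<omega> by (simp add: pos_divide_le_eq)
      finally show ?thesis by simp
    qed
    then show "prob {w \<in> space M. \<exists>i. P w $ i \<le> s * (\<chi> i. \<omega> $ i / real CARD('n)) $ i} / s =
      prob {w \<in> space M. bonferroni_pvalue \<omega> (P w) \<le> s} / s" by simp
  qed simp
  ultimately show ?thesis by (rule Lim_transform_eventually)
qed

lemma combination_rejection_rate:
  fixes \<omega> :: "real ^ 'n"
  assumes \<omega>: "\<And>i. 0 < \<omega> $ i" and sum: "(\<Sum>i\<in>UNIV. \<omega> $ i) = real CARD('n)"
    and F: "reg_varying_cdf_star 1 F"
  shows "((\<lambda>\<alpha>. prob {w \<in> space M. comb_pvalue 1 F \<omega> (P w) \<le> \<alpha>} / \<alpha>) \<longlongrightarrow> 1) (at_right 0)"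
proof -
  define n where "n = real CARD('n)"
  have n: "n > 0" by (simp add: n_def)
  define S where "S w = (\<Sum>i\<in>UNIV. max 0 (\<omega> $ i / n / P w $ i))" for w
  define T where "T w = comb_statistic F \<omega> (P w)" for w
  have [measurable]: "S \<in> borel_measurable M" unfolding S_def by measurable
  have T_meas [measurable]: "T \<in> borel_measurable M"
  proof -
    have "(\<lambda>w. quantile F (max 0 (1 - P w $ i / \<omega> $ i))) \<in> borel_measurable M" for i
      by (rule measurable_compose[OF _ borel_measurable_quantile[OF F]]) measurable
    then show ?thesis unfolding T_def comb_statistic_def by (intro borel_measurable_times borel_measurable_sum) auto
  qed
  have cdf: "is_cdf F" using F by (auto simp: reg_varying_cdf_star_def reg_varying_cdf_def)
  have [measurable]: "F \<in> borel_measurable borel"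
    by (intro borel_measurable_mono monoI is_cdfD(1)[OF cdf])
  have [measurable]: "(\<lambda>w. F (T w)) \<in> borel_measurable M"
    by (rule measurable_compose[of T M borel F]) measurable
  define R where "R \<alpha> = prob {w \<in> space M. 1 - F (T w) \<le> \<alpha>}" for \<alpha>
  have S_lim: "((\<lambda>\<alpha>. prob {w \<in> space M. b / \<alpha> \<le> S w} / \<alpha>) \<longlongrightarrow> 1 / b) (at_right 0)"
    if b: "b > 0" for b
  proof -
    have "((\<lambda>t. t * prob {w \<in> space M. t \<le> S w}) \<longlongrightarrow> 1) at_top"
      unfolding S_def using weighted_sum_tail[of "\<lambda>i. \<omega> $ i / n"] \<omega> n sum
      by (simp add: n_def sum_divide_distrib[symmetric])
    moreover have "filterlim (\<lambda>\<alpha>. b / \<alpha>) at_top (at_right 0)"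
      unfolding divide_inverse using b
      by (intro filterlim_tendsto_pos_mult_at_top[OF tendsto_const] filterlim_inverse_at_top_right)
    ultimately have "((\<lambda>\<alpha>. b / \<alpha> * prob {w \<in> space M. b / \<alpha> \<le> S w}) \<longlongrightarrow> 1) (at_right 0)"
      by (rule filterlim_compose)
    then have "((\<lambda>\<alpha>. b / \<alpha> * prob {w \<in> space M. b / \<alpha> \<le> S w} / b) \<longlongrightarrow> 1 / b) (at_right 0)"
      by (intro tendsto_divide) (use b in auto)
    then show ?thesis using b by (simp add: divide_simps) 
  qed
  have bounds: "eventually (\<lambda>\<alpha>. prob {w \<in> space M. (1 + \<epsilon>) / \<alpha> \<le> S w} / \<alpha> \<le> R \<alpha> / \<alpha> \<and>
      R \<alpha> / \<alpha> \<le> prob {w \<in> space M. (1 - \<epsilon>) / \<alpha> \<le> S w} / \<alpha>) (at_right 0)" if \<epsilon>: "\<epsilon> > 0" for \<epsilon>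
    using mean_quantile_comparison[OF F \<epsilon>, where 'n='n] eventually_at_right_less[of 0]
  proof eventually_elim
    case (elim \<alpha>)
    have cmp: "AE w in M. ((1 + \<epsilon>) / \<alpha> \<le> S w \<longrightarrow> 1 - F (T w) \<le> \<alpha>) \<and>
                 (1 - F (T w) \<le> \<alpha> \<longrightarrow> (1 - \<epsilon>) / \<alpha> \<le> S w)"
      using P_pos
    proof eventually_elim
      fix w assume pos: "\<forall>i. 0 < P w $ i"
      have "S w = (\<Sum>i\<in>UNIV. \<omega> $ i / P w $ i) / n"
        unfolding S_def sum_divide_distrib
        using pos \<omega> n by (intro sum.cong) (auto simp: max_def not_le field_simps less_imp_le)
      moreover have "T w = (1 / real CARD('n)) *
          (\<Sum>i\<in>UNIV. quantile F (max 0 (1 - 1 / (\<omega> $ i / P w $ i))))"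
        by (simp add: T_def comb_statistic_def)
      moreover have "\<forall>i. 0 < \<omega> $ i / P w $ i" using pos \<omega> by simp
      ultimately show "((1 + \<epsilon>) / \<alpha> \<le> S w \<longrightarrow> 1 - F (T w) \<le> \<alpha>) \<and>
                 (1 - F (T w) \<le> \<alpha> \<longrightarrow> (1 - \<epsilon>) / \<alpha> \<le> S w)"
        using elim(1)[rule_format, of "\<lambda>i. \<omega> $ i / P w $ i"] by (simp add: n_def)
    qed
    have "prob {w \<in> space M. (1 + \<epsilon>) / \<alpha> \<le> S w} \<le> R \<alpha>"
      unfolding R_def
    proof (rule finite_measure_mono_AE)
      show "AE w in M. w \<in> {w \<in> space M. (1 + \<epsilon>) / \<alpha> \<le> S w}
          \<longrightarrow> w \<in> {w \<in> space M. 1 - F (T w) \<le> \<alpha>}"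
        using cmp by eventually_elim simp
    qed measurable
    moreover have "R \<alpha> \<le> prob {w \<in> space M. (1 - \<epsilon>) / \<alpha> \<le> S w}"
      unfolding R_def
    proof (rule finite_measure_mono_AE)
      show "AE w in M. w \<in> {w \<in> space M. 1 - F (T w) \<le> \<alpha>}
          \<longrightarrow> w \<in> {w \<in> space M. (1 - \<epsilon>) / \<alpha> \<le> S w}"
        using cmp by eventually_elim simp
    qed measurable
    ultimately show ?case using elim(2) by (auto intro: divide_right_mono)
  qed
  have "((\<lambda>\<alpha>. R \<alpha> / \<alpha>) \<longlongrightarrow> 1) (at_right 0)"
  proof (rule order_tendstoI)
    fix a :: real assume a: "a < 1"
    have "((\<lambda>\<epsilon>. 1 / (1 + \<epsilon>)) \<longlongrightarrow> 1 / (1 + 0)) (at_right (0::real))"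
      by (intro tendsto_intros) auto
    then have "eventually (\<lambda>\<epsilon>. a < 1 / (1 + \<epsilon>)) (at_right 0)" using a by (intro order_tendstoD) auto
    then have "eventually (\<lambda>\<epsilon>. a < 1 / (1 + \<epsilon>) \<and> 0 < \<epsilon>) (at_right 0)"
      using eventually_at_right_less[of 0] by (rule eventually_conj)
    then obtain \<epsilon> :: real where \<epsilon>: "a < 1 / (1 + \<epsilon>)" "0 < \<epsilon>"
      using eventually_happens'[OF trivial_limit_at_right_real] by blast
    have "eventually (\<lambda>\<alpha>. a < prob {w \<in> space M. (1 + \<epsilon>) / \<alpha> \<le> S w} / \<alpha>) (at_right 0)"
      by (rule order_tendstoD(1)[OF S_lim \<epsilon>(1)]) (use \<epsilon> in auto)
    with bounds[OF \<epsilon>(2)] show "eventually (\<lambda>\<alpha>. a < R \<alpha> / \<alpha>) (at_right 0)"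
      by eventually_elim linarith
  next
    fix a :: real assume a: "1 < a"
    have "((\<lambda>\<epsilon>. 1 / (1 - \<epsilon>)) \<longlongrightarrow> 1 / (1 - 0)) (at_right (0::real))"
      by (intro tendsto_intros) auto
    then have "eventually (\<lambda>\<epsilon>. 1 / (1 - \<epsilon>) < a) (at_right 0)" using a by (intro order_tendstoD) auto
    moreover have "eventually (\<lambda>\<epsilon>::real. 0 < \<epsilon> \<and> \<epsilon> < 1) (at_right 0)"
      by (rule eventually_at_rightI[of 0 1]) auto
    ultimately have "eventually (\<lambda>\<epsilon>. 1 / (1 - \<epsilon>) < a \<and> 0 < \<epsilon> \<and> \<epsilon> < 1) (at_right 0)"
      by (rule eventually_conj)
    then obtain \<epsilon> :: real where \<epsilon>: "1 / (1 - \<epsilon>) < a" "0 < \<epsilon>" "\<epsilon> < 1"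
      using eventually_happens'[OF trivial_limit_at_right_real] by blast
    have "eventually (\<lambda>\<alpha>. prob {w \<in> space M. (1 - \<epsilon>) / \<alpha> \<le> S w} / \<alpha> < a) (at_right 0)"
      by (rule order_tendstoD(2)[OF S_lim \<epsilon>(1)]) (use \<epsilon> in auto)
    with bounds[OF \<epsilon>(2)] show "eventually (\<lambda>\<alpha>. R \<alpha> / \<alpha> < a) (at_right 0)"
      by eventually_elim linarith
  qed
  moreover have "eventually (\<lambda>\<alpha>. R \<alpha> / \<alpha>
      = prob {w \<in> space M. comb_pvalue 1 F \<omega> (P w) \<le> \<alpha>} / \<alpha>) (at_right 0)"
    by (rule eventually_at_rightI[of 0 1])
       (auto simp: R_def T_def comb_pvalue_def survival_def min_le_iff_disj
             intro!: arg_cong[where f=prob])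
  ultimately show ?thesis by (rule Lim_transform_eventually)
qed

lemma type1_error_ratio_limit:
  fixes \<omega> :: "real ^ 'n"
  assumes \<omega>: "\<And>i. 0 < \<omega> $ i" and sum: "(\<Sum>i\<in>UNIV. \<omega> $ i) = real CARD('n)"
    and F: "reg_varying_cdf_star 1 F"
  shows "(type1_error_ratio M 1 F \<omega> P \<longlongrightarrow> 1 / l (\<chi> i. \<omega> $ i / real CARD('n))) (at_right 0)"
proof -
  define v :: "real ^ 'n" where "v = (\<chi> i. \<omega> $ i / real CARD('n))"
  have v: "0 < v $ i" for i using \<omega> by (simp add: v_def)
  have "0 < l v" using v tail_ge_component[of v] by (meson less_imp_le less_le_trans)
  then have "((\<lambda>\<alpha>. (prob {w \<in> space M. comb_pvalue 1 F \<omega> (P w) \<le> \<alpha>} / \<alpha>) /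
      (prob {w \<in> space M. bonferroni_pvalue \<omega> (P w) \<le> \<alpha>} / \<alpha>)) \<longlongrightarrow> 1 / l v) (at_right 0)"
    using combination_rejection_rate[OF assms] bonferroni_rejection_rate[OF \<omega>]
    by (intro tendsto_divide) (auto simp: v_def)
  moreover have "eventually (\<lambda>\<alpha>. (prob {w \<in> space M. comb_pvalue 1 F \<omega> (P w) \<le> \<alpha>} / \<alpha>) /
      (prob {w \<in> space M. bonferroni_pvalue \<omega> (P w) \<le> \<alpha>} / \<alpha>)
      = type1_error_ratio M 1 F \<omega> P \<alpha>) (at_right 0)"
    by (rule eventually_at_rightI[of 0 1]) (auto simp: type1_error_ratio_def)
  ultimately show ?thesis unfolding v_def by (rule Lim_transform_eventually)
qed

end

section \<open>From the limiting copula to the tail limit\<close>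

lemma tendsto_one_minus_powr:
  fixes y :: "real \<Rightarrow> real"
  assumes y0: "\<And>t. 0 \<le> y t" and lim: "((\<lambda>t. t * y t) \<longlongrightarrow> L) at_top"
  shows "((\<lambda>t. (1 - y t) powr t) \<longlongrightarrow> exp (- L)) at_top"
proof -
  have "((\<lambda>t. t * y t * inverse t) \<longlongrightarrow> L * 0) at_top"
    by (intro tendsto_mult lim tendsto_inverse_0_at_top filterlim_ident)
  moreover have "eventually (\<lambda>t. t * y t * inverse t = y t) at_top"
    using eventually_gt_at_top[of 0] by eventually_elim simp
  ultimately have "(y \<longlongrightarrow> L * 0) at_top" by (rule Lim_transform_eventually)
  then have ylim: "(y \<longlongrightarrow> 0) at_top" by simp
  then have "eventually (\<lambda>t. y t < 1/2) at_top" by (intro order_tendstoD) auto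
  then have small: "eventually (\<lambda>t. y t \<le> 1/2 \<and> t > 0) at_top"
    using eventually_gt_at_top[of 0] by eventually_elim auto
  have "((\<lambda>t. t * ln (1 - y t)) \<longlongrightarrow> - L) at_top"
  proof (rule tendsto_sandwich)
    show "eventually (\<lambda>t. - (t * y t) - 2 * (t * y t * y t) \<le> t * ln (1 - y t)) at_top"
      using small
    proof eventually_elim
      case (elim t)
      have "t * (- y t - 2 * (y t)\<^sup>2) \<le> t * ln (1 - y t)"
        using elim y0[of t] by (intro mult_left_mono ln_one_minus_pos_lower_bound) auto
      then show ?case by (simp add: algebra_simps power2_eq_square)
    qed
    show "eventually (\<lambda>t. t * ln (1 - y t) \<le> - (t * y t)) at_top"
      using small
    proof eventually_elim
      case (elim t)
      have "t * ln (1 - y t) \<le> t * (- y t)"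
        using elim y0[of t] by (intro mult_left_mono ln_one_minus_pos_upper_bound) auto
      then show ?case by simp
    qed
    have "((\<lambda>t. - (t * y t) - 2 * (t * y t * y t)) \<longlongrightarrow> - L - 2 * (L * 0)) at_top"
      by (intro tendsto_intros lim ylim)
    then show "((\<lambda>t. - (t * y t) - 2 * (t * y t * y t)) \<longlongrightarrow> - L) at_top" by simp
    show "((\<lambda>t. - (t * y t)) \<longlongrightarrow> - L) at_top" by (intro tendsto_intros lim)
  qed
  then have "((\<lambda>t. exp (t * ln (1 - y t))) \<longlongrightarrow> exp (- L)) at_top" by (intro tendsto_exp)
  moreover have "eventually (\<lambda>t. exp (t * ln (1 - y t)) = (1 - y t) powr t) at_top"
    using small by eventually_elim (auto simp: powr_def)
  ultimately show ?thesis by (rule Lim_transform_eventually)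
qed

text \<open>
  At \<open>u\<^sub>i = exp (- v\<^sub>i)\<close> the copula argument \<open>u\<^sub>i\<close> to the power \<open>1 / t\<close> is \<open>exp (- v\<^sub>i / t)\<close>, that is,
  \<open>1 - v\<^sub>i / t\<close> up to \<open>o(1 / t)\<close>. The error is negligible since the union probability is
  Lipschitz, so the copula there is \<open>1 - l v / t\<close> up to \<open>o(1 / t)\<close>, and its \<open>t\<close>-th power
  tends to \<open>exp (- l v)\<close>.
\<close>

lemma mrv_pvaluesE:
  fixes P :: "'a \<Rightarrow> real ^ 'n"
  assumes "mrv_pvalues M P Cs"
  obtains l where "tail_dependent_pvalues M P l"
    "\<And>v. (\<And>i. 0 < v $ i) \<Longrightarrow> Cs (\<chi> i. exp (- v $ i)) = exp (- l v)"
proof -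
  have "prob_space M" and P [measurable]: "P \<in> borel_measurable M"
    using assms by (auto simp: mrv_pvalues_def)
  obtain C where mrv: "mrv_copula C"
    and joint: "\<And>u. u \<in> unit_cube \<Longrightarrow> joint_cdf M (\<lambda>w. \<chi> i. 1 - P w $ i) u = C u"
    and lim: "limiting_copula C Cs"
    using assms by (auto simp: mrv_pvalues_def)
  have Cs: "((\<lambda>t. C (\<chi> i. u $ i powr (1 / t)) powr t) \<longlongrightarrow> Cs u) at_top"
    if "u \<in> unit_cube" for u
    using lim that by (simp add: limiting_copula_def)
  have C: "copula C" using mrv by (simp add: mrv_copula_def)
  obtain l where l: "\<And>v. (\<And>i. 0 \<le> v $ i) \<Longrightarrow>
      ((\<lambda>s. copula_dual C (s *\<^sub>R v) / s) \<longlongrightarrow> l v) (at_right 0)"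
    using mrv by (auto simp: mrv_copula_def)
  interpret prob_space M by fact
  have [measurable]: "(\<lambda>w. P w $ i) \<in> borel_measurable M" for i
    by (rule measurable_compose[OF P borel_measurable_component])
  have C_eq: "C u = prob {w \<in> space M. \<forall>i. 1 - P w $ i \<le> u $ i}" if "u \<in> unit_cube" for u
    using joint[OF that] by (simp add: joint_cdf_def)
  have dual_strict: "copula_dual C u = prob {w \<in> space M. \<exists>i. P w $ i < u $ i}"
    if "u \<in> unit_cube" for u
  proof -
    have "copula_dual C u = 1 - prob {w \<in> space M. \<forall>i. 1 - P w $ i \<le> 1 - u $ i}"
      using that unfolding copula_dual_def by (subst C_eq) (auto simp: unit_cube_def)
    also have "\<dots> = prob (space M - {w \<in> space M. \<forall>i. 1 - P w $ i \<le> 1 - u $ i})"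
      by (subst prob_compl) auto
    also have "space M - {w \<in> space M. \<forall>i. 1 - P w $ i \<le> 1 - u $ i}
        = {w \<in> space M. \<exists>i. P w $ i < u $ i}" by (auto simp flip: not_le)
    finally show ?thesis .
  qed
  \<comment> \<open>The copula value at \<open>(1, \<dots>, 1)\<close> rules out negative p-values.\<close>
  have nonneg: "AE w in M. \<forall>i. 0 \<le> P w $ i"
  proof -
    have "C (\<chi> j. 1) = 1" using copula_marginal[OF C, of 1 undefined] by simp
    moreover have "C (\<chi> j. 1) = prob {w \<in> space M. \<forall>i. 0 \<le> P w $ i}"
      by (subst C_eq) (auto simp: unit_cube_def)
    ultimately have "prob {w \<in> space M. \<forall>i. 0 \<le> P w $ i} = 1" by simp
    then show ?thesis by (subst (asm) prob_eq_1) auto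
  qed
  have strict: "prob {w \<in> space M. P w $ i < s} = s" if s: "0 \<le> s" "s \<le> 1" for i s
  proof -
    have "1 - s = C (\<chi> j. if j = i then 1 - s else 1)"
      using s by (simp add: copula_marginal[OF C])
    also have "\<dots> = prob {w \<in> space M. \<forall>j. 1 - P w $ j \<le> (if j = i then 1 - s else 1)}"
      using s by (subst C_eq) (auto simp: unit_cube_def)
    also have "\<dots> = prob {w \<in> space M. s \<le> P w $ i}"
    proof (intro finite_measure_eq_AE)
      show "AE w in M. w \<in> {w \<in> space M. \<forall>j. 1 - P w $ j \<le> (if j = i then 1 - s else 1)}
          \<longleftrightarrow> w \<in> {w \<in> space M. s \<le> P w $ i}"
        using nonneg by eventually_elim (auto split: if_splits)
    qed measurable
    also have "\<dots> = 1 - prob {w \<in> space M. P w $ i < s}"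
    proof -
      have "space M - {w \<in> space M. P w $ i < s} = {w \<in> space M. s \<le> P w $ i}" by auto
      then show ?thesis using prob_compl[of "{w \<in> space M. P w $ i < s}"] by simp
    qed
    finally show ?thesis by simp
  qed
  have marg: "prob {w \<in> space M. P w $ i \<le> s} = s" if s: "0 \<le> s" "s \<le> 1" for i s
  proof (rule antisym)
    show "s \<le> prob {w \<in> space M. P w $ i \<le> s}"
    proof -
      have "s = prob {w \<in> space M. P w $ i < s}" using strict[OF s] by simp
      also have "\<dots> \<le> prob {w \<in> space M. P w $ i \<le> s}" by (intro finite_measure_mono) auto
      finally show ?thesis .
    qed
    show "prob {w \<in> space M. P w $ i \<le> s} \<le> s"
    proof (cases "s = 1")
      case False
      show ?thesis
      proof (rule dense_ge_bounded[of s 1])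
        fix r assume r: "s < r" "r < 1"
        have "prob {w \<in> space M. P w $ i \<le> s} \<le> prob {w \<in> space M. P w $ i < r}"
          using r by (intro finite_measure_mono) auto
        then show "prob {w \<in> space M. P w $ i \<le> s} \<le> r" using strict[of r i] r s by simp
      qed (use False s in auto)
    qed simp
  qed
  have pos: "AE w in M. \<forall>i. 0 < P w $ i"
  proof -
    have "AE w in M. \<not> P w $ i \<le> 0" for i
    proof -
      have "prob {w \<in> space M. P w $ i \<le> 0} = 0" by (rule marg) auto
      then show ?thesis by (subst (asm) prob_eq_0) auto
    qed
    then show ?thesis by (simp add: AE_all_countable not_le)
  qed
  \<comment> \<open>Uniform marginals have no atoms, so strict and weak inequalities agree.\<close>
  have dual: "copula_dual C u = prob {w \<in> space M. \<exists>i. P w $ i \<le> u $ i}" if "u \<in> unit_cube" for u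
  proof -
    have u: "0 \<le> u $ i" "u $ i \<le> 1" for i using that by (auto simp: unit_cube_def)
    have "AE w in M. P w $ i \<noteq> u $ i" for i
    proof -
      have "prob ({w \<in> space M. P w $ i \<le> u $ i} - {w \<in> space M. P w $ i < u $ i}) = u $ i - u $ i"
        using u by (subst finite_measure_Diff) (auto simp: marg strict)
      moreover have "{w \<in> space M. P w $ i \<le> u $ i} - {w \<in> space M. P w $ i < u $ i}
          = {w \<in> space M. P w $ i = u $ i}" by auto
      ultimately have "prob {w \<in> space M. P w $ i = u $ i} = 0" by simp
      then show ?thesis by (subst (asm) prob_eq_0) auto
    qed
    then have "AE w in M. \<forall>i. P w $ i \<noteq> u $ i" by (simp add: AE_all_countable)
    then have "AE w in M. w \<in> {w \<in> space M. \<exists>i. P w $ i < u $ i}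
        \<longleftrightarrow> w \<in> {w \<in> space M. \<exists>i. P w $ i \<le> u $ i}"
      by eventually_elim (auto simp: less_le)
    then show ?thesis unfolding dual_strict[OF that]
      by (rule finite_measure_eq_AE) measurable
  qed
  have cube: "eventually (\<lambda>s. s *\<^sub>R v \<in> unit_cube) (at_right 0)" if v: "\<And>i. 0 \<le> v $ i" for v :: "real ^ 'n"
  proof -
    define m where "m = 1 + (\<Sum>i\<in>UNIV. v $ i)"
    have vm: "v $ i \<le> m" for i
      using member_le_sum[of i UNIV "\<lambda>i. v $ i"] v by (simp add: m_def)
    have m: "m > 0" using v by (simp add: m_def add_pos_nonneg sum_nonneg)
    show ?thesis
    proof (rule eventually_at_rightI[of 0 "1 / m"])
      fix s :: real assume s: "s \<in> {0<..<1 / m}"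
      have "s * v $ i \<le> 1" for i
      proof -
        have "s * v $ i \<le> s * m" using s vm[of i] by (intro mult_left_mono) auto
        also have "\<dots> \<le> 1" using s m by (simp add: field_simps)
        finally show ?thesis .
      qed
      then show "s *\<^sub>R v \<in> unit_cube" using s v by (simp add: unit_cube_def)
    qed (use m in auto)
  qed
  have tl: "((\<lambda>s. prob {w \<in> space M. \<exists>i. P w $ i \<le> s * v $ i} / s) \<longlongrightarrow> l v) (at_right 0)"
    if v: "\<And>i. 0 \<le> v $ i" for v
  proof -
    have "eventually (\<lambda>s. copula_dual C (s *\<^sub>R v) / s
        = prob {w \<in> space M. \<exists>i. P w $ i \<le> s * v $ i} / s) (at_right 0)"
      using cube[OF v] by eventually_elim (simp add: dual)
    with l[OF v] show ?thesis by (rule Lim_transform_eventually)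
  qed
  interpret tail_dependent_pvalues M P l
    by unfold_locales (use P pos marg tl in auto)
  have "Cs (\<chi> i. exp (- v $ i)) = exp (- l v)" if v: "\<And>i. 0 < v $ i" for v
  proof (rule tendsto_unique)
    have v0: "0 \<le> v $ i" for i using v[of i] by simp
    define b where "b t i = 1 - exp (- (v $ i / t))" for t i
    define a where "a t i = v $ i / t" for t i
    define Db where "Db t = prob {w \<in> space M. \<exists>i. P w $ i \<le> b t i}" for t
    define Da where "Da t = prob {w \<in> space M. \<exists>i. P w $ i \<le> a t i}" for t
    have b01: "0 \<le> b t i" "b t i \<le> 1" "b t i \<le> a t i" if "t > 0" for t i
      using that v0[of i] exp_ge_add_one_self[of "- (v $ i / t)"] by (auto simp: b_def a_def)
    have "eventually (\<lambda>t. inverse t *\<^sub>R v \<in> unit_cube) at_top"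
      using cube[OF v0] filterlim_inverse_at_right_top by (rule eventually_compose_filterlim)
    then have a1: "eventually (\<lambda>t. \<forall>i. a t i \<le> 1) at_top"
      by eventually_elim (auto simp: a_def unit_cube_def divide_inverse mult.commute)
    have Da: "((\<lambda>t. t * Da t) \<longlongrightarrow> l v) at_top"
      unfolding Da_def a_def by (rule tail_at_top[OF v0])
    have "((\<lambda>t. t * Db t) \<longlongrightarrow> l v) at_top"
    proof (rule tendsto_sandwich)
      show "eventually (\<lambda>t. t * Db t \<le> t * Da t) at_top"
        using eventually_gt_at_top[of 0]
      proof eventually_elim
        case (elim t)
        then show ?case unfolding Da_def Db_def
          by (intro mult_left_mono finite_measure_mono) (auto intro: order_trans[OF _ b01(3)])
      qed
      show "eventually (\<lambda>t. t * Da t - (\<Sum>i\<in>UNIV. t * (a t i - b t i)) \<le> t * Db t) at_top"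
        using eventually_gt_at_top[of 0] a1
      proof eventually_elim
        case (elim t)
        have "Da t \<le> Db t + (\<Sum>i\<in>UNIV. a t i - b t i)"
          unfolding Da_def Db_def by (intro union_lipschitz) (use elim b01 in auto)
        then have "t * Da t \<le> t * (Db t + (\<Sum>i\<in>UNIV. a t i - b t i))"
          using elim by (intro mult_left_mono) auto
        then show ?case by (simp add: distrib_left sum_distrib_left)
      qed
      have "((\<lambda>t. t * (a t i - b t i)) \<longlongrightarrow> 0) at_top" for i
        unfolding a_def b_def using v[of i] by real_asymp
      then have "((\<lambda>t. t * Da t - (\<Sum>i\<in>UNIV. t * (a t i - b t i))) \<longlongrightarrow> l v - (\<Sum>i\<in>(UNIV::'n set). 0)) at_top"
        by (intro tendsto_diff Da tendsto_sum)
      then show "((\<lambda>t. t * Da t - (\<Sum>i\<in>UNIV. t * (a t i - b t i))) \<longlongrightarrow> l v) at_top" by simp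
    qed (rule Da)
    then have lim: "((\<lambda>t. (1 - Db t) powr t) \<longlongrightarrow> exp (- l v)) at_top"
      by (intro tendsto_one_minus_powr) (simp add: Db_def)
    have "eventually (\<lambda>t. (1 - Db t) powr t
        = C (\<chi> i. (\<chi> i. exp (- v $ i)) $ i powr (1 / t)) powr t) at_top"
      using eventually_gt_at_top[of 0]
    proof eventually_elim
      case (elim t)
      have "Db t = copula_dual C (\<chi> i. b t i)"
        using b01[OF elim] unfolding Db_def by (subst dual) (auto simp: unit_cube_def)
      also have "\<dots> = 1 - C (\<chi> i. exp (- (v $ i / t)))"
        by (simp add: copula_dual_def b_def)
      finally show ?case by (simp add: powr_def)
    qed
    with lim show "((\<lambda>t. C (\<chi> i. (\<chi> i. exp (- v $ i)) $ i powr (1 / t)) powr t) \<longlongrightarrow> exp (- l v)) at_top"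
      by (rule Lim_transform_eventually)
    show "((\<lambda>t. C (\<chi> i. (\<chi> i. exp (- v $ i)) $ i powr (1 / t)) powr t) \<longlongrightarrow> Cs (\<chi> i. exp (- v $ i))) at_top"
      by (rule Cs) (use v0 in \<open>auto simp: unit_cube_def\<close>)
  qed simp
  then show ?thesis using that tail_dependent_pvalues_axioms by blast
qed

section \<open>Monotonicity of the asymptotic error ratio\<close>

theorem theorem4p6:
  fixes M1 :: "'a measure" and M2 :: "'b measure"
    and P1 :: "'a \<Rightarrow> real ^ 'n" and P2 :: "'b \<Rightarrow> real ^ 'n"
    and Cs1 Cs2 :: "real ^ 'n \<Rightarrow> real"
    and \<omega> :: "real ^ 'n" and F :: "real \<Rightarrow> real"
  assumes "\<And>i. 0 < \<omega> $ i"
    and "(\<Sum>i\<in>UNIV. \<omega> $ i) = real CARD('n)"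
    and "reg_varying_cdf_star 1 F"
    and "mrv_pvalues M1 P1 Cs1"
    and "mrv_pvalues M2 P2 Cs2"
  shows "\<exists>r1 r2. (type1_error_ratio M1 1 F \<omega> P1 \<longlongrightarrow> r1) (at_right 0) \<and>
                 (type1_error_ratio M2 1 F \<omega> P2 \<longlongrightarrow> r2) (at_right 0) \<and>
                 (Cs1 \<preceq>\<^sub>p\<^sub>w Cs2 \<longrightarrow> r1 \<le> r2)"
proof -
  define v :: "real ^ 'n" where "v = (\<chi> i. \<omega> $ i / real CARD('n))"
  have v: "0 < v $ i" for i using assms(1) by (simp add: v_def)
  obtain l1 where T1: "tail_dependent_pvalues M1 P1 l1"
    and l1: "Cs1 (\<chi> i. exp (- v $ i)) = exp (- l1 v)"
    using mrv_pvaluesE[OF assms(4)] v by metis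
  obtain l2 where T2: "tail_dependent_pvalues M2 P2 l2"
    and l2: "Cs2 (\<chi> i. exp (- v $ i)) = exp (- l2 v)"
    using mrv_pvaluesE[OF assms(5)] v by metis
  have "v $ i \<le> l2 v" for i
    by (rule tail_dependent_pvalues.tail_ge_component[OF T2]) (simp add: v less_imp_le)
  then have pos: "0 < l2 v" using v less_le_trans by blast
  have "(\<chi> i. exp (- v $ i)) \<in> unit_cube" using v by (auto simp: unit_cube_def less_imp_le)
  then have "exp (- l1 v) \<le> exp (- l2 v)" if "Cs1 \<preceq>\<^sub>p\<^sub>w Cs2"
    using that unfolding pw_le_def l1[symmetric] l2[symmetric] by blast
  then have "1 / l1 v \<le> 1 / l2 v" if "Cs1 \<preceq>\<^sub>p\<^sub>w Cs2"
    using that pos by (auto intro!: divide_left_mono)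
  then show ?thesis
    using tail_dependent_pvalues.type1_error_ratio_limit[OF T1 assms(1-3)]
      tail_dependent_pvalues.type1_error_ratio_limit[OF T2 assms(1-3)]
    unfolding v_def by blast
qed

end
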